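(* Let $\sigma\ge\tau\ge1$, $\sigma>1$, and put $\alpha_\star^{(\sigma)}=\sigma^{\sigma/(\sigma-1)}$, $\Delta_\star^{(\sigma)}=\sigma^{1/(\sigma-1)}$. For any strongly $(\tau,\sigma)$-elastic cost function $f$, the following are true: (a) If $\alpha=\alpha_\star^{(\sigma)}$, there exists a unique linear reserve function, $\phi(y)=\Delta_\star^{(\sigma)}y$, such that PUMax-$\phi$ is $\alpha_\star^{(\sigma)}$-competitive for OACC with cost $f$. (b) If $\alpha>\alpha_\star^{(\sigma)}$, there exist infinitely many linear reserve functions $\phi$, bounded above by $\Delta^{(\sigma)}_+y$ and below by $\Delta^{(\sigma)}_-y$, such that PUMax-$\phi$ is $\alpha$-competitive for OACC with cost $f$, where $\Delta^{(\sigma)}_+\ge\Delta^{(\sigma)}_-$ are the two positive roots of $z^{\sigma}-\frac{\alpha}{\sigma-1}(z^{\sigma-1}-1)$.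
   Context: OACC (online allocation with convex costs). There are $m\ge 1$ offline supply nodes, all with the same cost function $f$. An instance $I$ is a finite sequence $(\mathbf v_t,\mathbf w_t)_{t=1}^T$ with $v_{t,j}\ge0$, $w_{t,j}>0$, $j\in[m]$. When demand $t$ arrives, an irrevocable allocation $\mathbf x_t\in\mathcal X=\{\mathbf x\in\mathbb{R}_+^m:\sum_jx_j\le1\}$ is chosen. The objective is $\sum_t\sum_jv_{t,j}x_{t,j}-\sum_jf(\sum_tw_{t,j}x_{t,j})$; $\mathrm{OPT}(I)$ is its offline maximum and $\mathrm{ALG}(I)$ the online value. An online algorithm is $\alpha$-competitive if $\mathrm{OPT}(I)\le\alpha\,\mathrm{ALG}(I)$ for all $I$. PUMax-$\phi$: start with $y_{0,j}=0$; upon arrival of $t$ choose $\mathbf x_t\in\arg\max_{\mathbf x\in\mathcal X}\sum_jv_{t,j}x_j-\sum_j\int_{y_{t-1,j}}^{y_{t-1,j}+w_{t,j}x_j}f'(\phi(\eta))\,d\eta$ and set $y_{t,j}=y_{t-1,j}+w_{t,j}x_{t,j}$. The function $\phi$ is called the reserve function; a linear reserve function is one of the form $\phi(y)=ky$. Elasticity: $Eg(y)=yg'(y)/g(y)$. A cost $f:\mathbb{R}_+\to\mathbb{R}_+$ is $(\tau,\sigma)$-elastic if it is increasing, smooth, strictly convex, analytic at the origin, $f(0)=f'(0)=0$, $Ef'$ is non-decreasing on $(0,\infty)$, and $\tau-1\le Ef'\le\sigma-1$ on $(0,\infty)$; it is strongly $(\tau,\sigma)$-elastic if it moreover satisfies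 $\tau-2\le Ef''\le\sigma-2$ on $(0,\infty)$.
   Formalization: Uniqueness in (a) fails for a fixed f if σ can be lowered (f=y², τ=2, σ=3: slopes √3 and 2 both work); it is proved for f not (τ,σ')-elastic for any σ'<σ, and, for all σ, as uniqueness among linear reserves competitive for every strongly (τ,σ)-elastic cost. *)

theory Defs
  imports "HOL-Analysis.Analysis"
begin

section \<open>Elastic cost functions\<close>

text \<open>
  A cost function maps the half-line of non-negative reals to itself. It is represented by a total
  function on the reals of which only the values on the half-line matter; derivatives are therefore
  taken within the half-line (so they are one-sided at the origin).
\<close>

definition hderiv :: "(real \<Rightarrow> real) \<Rightarrow> real \<Rightarrow> real" where
  "hderiv f x = vector_derivative f (at x within {0..})"

definition smooth_half_line :: "(real \<Rightarrow> real) \<Rightarrow> bool" where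
  "smooth_half_line f \<longleftrightarrow> (\<forall>n. (hderiv ^^ n) f differentiable_on {0..})"

definition strictly_convex_on :: "real set \<Rightarrow> (real \<Rightarrow> real) \<Rightarrow> bool" where
  "strictly_convex_on S f \<longleftrightarrow>
     (\<forall>x\<in>S. \<forall>y\<in>S. \<forall>u. x \<noteq> y \<longrightarrow> 0 < u \<longrightarrow> u < 1 \<longrightarrow>
        f ((1 - u) * x + u * y) < (1 - u) * f x + u * f y)"

text \<open>A power series convergent on a right neighbourhood of the origin converges on a full
  neighbourhood, so this says that \<open>f\<close> extends to a function analytic near the origin.\<close>

definition analytic_at_origin :: "(real \<Rightarrow> real) \<Rightarrow> bool" where
  "analytic_at_origin f \<longleftrightarrow> (\<exists>a r. 0 < r \<and> (\<forall>x\<in>{0..<r}. (\<lambda>n. a n * x ^ n) sums f x))"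

definition elasticity :: "(real \<Rightarrow> real) \<Rightarrow> real \<Rightarrow> real" where
  "elasticity g y = y * hderiv g y / g y"

definition elastic :: "real \<Rightarrow> real \<Rightarrow> (real \<Rightarrow> real) \<Rightarrow> bool" where
  "elastic \<tau> \<sigma> f \<longleftrightarrow>
     (\<forall>y\<ge>0. 0 \<le> f y) \<and>
     strict_mono_on {0..} f \<and>
     smooth_half_line f \<and>
     strictly_convex_on {0..} f \<and>
     analytic_at_origin f \<and>
     f 0 = 0 \<and> hderiv f 0 = 0 \<and>
     mono_on {0<..} (elasticity (hderiv f)) \<and>
     (\<forall>y>0. \<tau> - 1 \<le> elasticity (hderiv f) y \<and> elasticity (hderiv f) y \<le> \<sigma> - 1)"

definition strongly_elastic :: "real \<Rightarrow> real \<Rightarrow> (real \<Rightarrow> real) \<Rightarrow> bool" where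
  "strongly_elastic \<tau> \<sigma> f \<longleftrightarrow>
     elastic \<tau> \<sigma> f \<and>
     (\<forall>y>0. \<tau> - 2 \<le> elasticity (hderiv (hderiv f)) y \<and>
            elasticity (hderiv (hderiv f)) y \<le> \<sigma> - 2)"

section \<open>Online allocation with convex costs\<close>

text \<open>
  Vectors indexed by the \<open>m\<close> supply nodes are functions on the naturals of which only the values
  below \<open>m\<close> matter. An instance is the list of pairs \<open>(v, w)\<close> of the successive demands; demands
  are numbered from \<open>0\<close>. A sequence of allocations is a function of the demand number.
\<close>

type_synonym vec = "nat \<Rightarrow> real"
type_synonym inst = "(vec \<times> vec) list"

definition is_instance :: "nat \<Rightarrow> inst \<Rightarrow> bool" where
  "is_instance m I \<longleftrightarrow> (\<forall>(v, w)\<in>set I. \<forall>j<m. 0 \<le> v j \<and> 0 < w j)"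

definition allocations :: "nat \<Rightarrow> vec set" where
  "allocations m = {x. (\<forall>j<m. 0 \<le> x j) \<and> (\<Sum>j<m. x j) \<le> 1}"

text \<open>The load of node \<open>j\<close> before demand number \<open>t\<close> arrives.\<close>

definition load :: "inst \<Rightarrow> (nat \<Rightarrow> vec) \<Rightarrow> nat \<Rightarrow> nat \<Rightarrow> real" where
  "load I x t j = (\<Sum>s<t. snd (I ! s) j * x s j)"

definition objective :: "nat \<Rightarrow> (real \<Rightarrow> real) \<Rightarrow> inst \<Rightarrow> (nat \<Rightarrow> vec) \<Rightarrow> real" where
  "objective m f I x =
     (\<Sum>t<length I. \<Sum>j<m. fst (I ! t) j * x t j) - (\<Sum>j<m. f (load I x (length I) j))"

definition OPT :: "nat \<Rightarrow> (real \<Rightarrow> real) \<Rightarrow> inst \<Rightarrow> real" where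
  "OPT m f I = (SUP x \<in> {x. \<forall>t<length I. x t \<in> allocations m}. objective m f I x)"

text \<open>
  An algorithm is given by the set of its possible runs (allocation sequences) on each instance;
  the competitive guarantee is required of every run, i.e. however ties are broken.
\<close>

definition competitive ::
  "nat \<Rightarrow> (real \<Rightarrow> real) \<Rightarrow> (inst \<Rightarrow> (nat \<Rightarrow> vec) set) \<Rightarrow> real \<Rightarrow> bool" where
  "competitive m f A \<alpha> \<longleftrightarrow>
     (\<forall>I. is_instance m I \<longrightarrow> A I \<noteq> {} \<and> (\<forall>x\<in>A I. OPT m f I \<le> \<alpha> * objective m f I x))"

definition PUMax ::
  "nat \<Rightarrow> (real \<Rightarrow> real) \<Rightarrow> (real \<Rightarrow> real) \<Rightarrow> inst \<Rightarrow> (nat \<Rightarrow> vec) set" where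
  "PUMax m f \<phi> I =
     {x. \<forall>t<length I.
        is_arg_max
          (\<lambda>z. (\<Sum>j<m. fst (I ! t) j * z j) -
               (\<Sum>j<m. integral {load I x t j .. load I x t j + snd (I ! t) j * z j}
                          (\<lambda>\<eta>. hderiv f (\<phi> \<eta>))))
          (\<lambda>z. z \<in> allocations m)
          (x t)}"

text \<open>The slope is non-negative because a reserve function takes values in the domain of the
  cost function.\<close>

definition linear_reserve :: "(real \<Rightarrow> real) \<Rightarrow> bool" where
  "linear_reserve \<phi> \<longleftrightarrow> (\<exists>k\<ge>0. \<phi> = (\<lambda>y. k * y))"

definition alpha_star :: "real \<Rightarrow> real" where
  "alpha_star \<sigma> = \<sigma> powr (\<sigma> / (\<sigma> - 1))"

definition Delta_star :: "real \<Rightarrow> real" where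
  "Delta_star \<sigma> = \<sigma> powr (1 / (\<sigma> - 1))"

end

theory Submission
  imports Defs
begin

text \<open>
  Write \<open>p = f'(k y)\<close> for the price at load \<open>y\<close> and \<open>H\<close> for its integral \<open>f(k y) / k\<close>. The final
  prices of PUMax bound the offline optimum by the first-order conditions of the algorithm's steps
  and Young's inequality, so the algorithm is \<open>\<alpha>\<close>-competitive as soon as
  \<open>k y p - f(k y) \<le> \<alpha> (H(y) - f(y))\<close> for all \<open>y\<close>. Conversely an adversary who raises the
  value of one node along the price curve and then offers one large demand at the final price forces
  this inequality. Differentiating it and bounding \<open>f''\<close> from below by a power through
  \<open>Ef'' \<le> \<sigma> - 2\<close>, one sees that it follows from
  \<open>k^\<sigma> \<le> \<alpha> / (\<sigma> - 1) * (k^(\<sigma> - 1) - 1)\<close>; letting \<open>y\<close> tend to infinity shows that this is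
  also necessary when \<open>Ef'\<close> approaches \<open>\<sigma> - 1\<close>. The rest is the sign pattern of this polynomial in \<open>k\<close>.
\<close>

section \<open>Prices and surplus\<close>

text \<open>For the pure power cost \<open>y powr \<sigma>\<close> the pointwise condition reads
  \<open>\<sigma> - 1 \<le> \<alpha> * (1 / k - k powr - \<sigma>)\<close> at every positive load.
  This is where the polynomial comes from, and no strongly elastic cost demands more. A single cost
  need not determine its slope, however: if \<open>f\<close> is also strongly elastic for a smaller
  \<open>\<sigma>'\<close>, further slopes can work at \<open>alpha_star \<sigma>\<close>.
  Uniqueness therefore has two forms, one for an \<open>f\<close> whose \<sigma> is sharp and one
  for slopes that serve the whole class. The second needs a sharp member of the class. A pure power
  will not do, since it is analytic at the origin only for integer \<sigma>. The remedy is a density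
  that behaves like an integer power at the origin and like \<open>y powr (\<sigma> - 1)\<close> at
  infinity; an integer that fits between \<tau> - 1 and \<sigma> - 1 is read off from the order of
  vanishing of \<open>f\<close> itself.\<close>

locale convex_cost =
  fixes f :: "real \<Rightarrow> real"
  assumes has_hderiv: "0 \<le> x \<Longrightarrow> (f has_real_derivative hderiv f x) (at x within {0..})"
    and hderiv_strict_mono: "strict_mono_on {0..} (hderiv f)"
    and zero: "f 0 = 0" and hderiv_zero: "hderiv f 0 = 0"
begin

lemma has_hderiv_at: "(f has_real_derivative hderiv f x) (at x)" if "0 < x"
proof -
  have "at x within {0..} = at x"
    using that by (intro at_within_interior) auto
  then show ?thesis using has_hderiv[of x] that by simp
qed

lemma continuous: "continuous_on {0..} f"
  using has_hderiv by (intro DERIV_continuous_on) auto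

lemma hderiv_less: "hderiv f a < hderiv f b" if "0 \<le> a" "a < b"
  using hderiv_strict_mono that by (auto simp: strict_mono_on_def)

lemma hderiv_le: "hderiv f a \<le> hderiv f b" if "0 \<le> a" "a \<le> b"
  using hderiv_less[of a b] that by (cases "a = b") auto

lemma hderiv_nonneg: "0 \<le> hderiv f a" if "0 \<le> a"
  using hderiv_le[of 0 a] hderiv_zero that by simp

lemma mvt:
  assumes "0 \<le> a" "a < b"
  obtains x where "a < x" "x < b" "f b - f a = (b - a) * hderiv f x"
proof -
  have "\<exists>l z. a < z \<and> z < b \<and> DERIV f z :> l \<and> f b - f a = (b - a) * l"
  proof (rule MVT[OF \<open>a < b\<close>])
    show "continuous_on {a..b} f" using assms by (auto intro: continuous_on_subset[OF continuous])
    show "f differentiable (at x)" if "a < x" for x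
      using has_hderiv_at[of x] assms that by (auto simp: real_differentiable_def)
  qed
  then obtain l z where z: "a < z" "z < b" "DERIV f z :> l" "f b - f a = (b - a) * l" by blast
  moreover have "l = hderiv f z"
    using DERIV_unique has_hderiv_at[of z] z assms by fastforce
  ultimately show ?thesis using that by blast
qed

lemma above_tangent_strict: "f a + hderiv f a * (b - a) < f b" if "0 \<le> a" "0 \<le> b" "a \<noteq> b"
proof (cases "a < b")
  case True
  then obtain x where x: "a < x" "x < b" "f b - f a = (b - a) * hderiv f x"
    by (rule mvt[OF \<open>0 \<le> a\<close>])
  then have "hderiv f a * (b - a) < hderiv f x * (b - a)"
    using hderiv_less[of a x] that True by simp
  also have "\<dots> = f b - f a" using x(3) by (simp only: mult.commute)
  finally show ?thesis by simp
next
  case False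
  then have "b < a" using that by simp
  then obtain x where x: "b < x" "x < a" "f a - f b = (a - b) * hderiv f x"
    by (rule mvt[OF \<open>0 \<le> b\<close>])
  then have "(a - b) * hderiv f x < (a - b) * hderiv f a"
    using hderiv_less[of x a] that \<open>b < a\<close> by simp
  with x show ?thesis by (simp add: algebra_simps)
qed

lemma above_tangent: "f a + hderiv f a * (b - a) \<le> f b" if "0 \<le> a" "0 \<le> b"
  using above_tangent_strict[OF that] by (cases "a = b") auto

lemma pos: "0 < f a" if "0 < a"
  using above_tangent_strict[of 0 a] zero hderiv_zero that by simp

lemma nonneg: "0 \<le> f a" if "0 \<le> a"
  using pos[of a] zero that by (cases "a = 0") auto

text \<open>The integral of the price \<open>hderiv f (k * \<eta>)\<close> over \<open>{0..y}\<close>; for \<open>k = 0\<close> the price is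
  \<open>hderiv f 0 = 0\<close>.\<close>

definition price_integral :: "real \<Rightarrow> real \<Rightarrow> real" where
  "price_integral k y = (if k = 0 then 0 else f (k * y) / k)"

lemma price_integral_zero [simp]: "price_integral k 0 = 0"
  by (simp add: price_integral_def zero)

lemma price_integral_has_derivative:
  assumes "0 \<le> k" "0 \<le> y"
  shows "(price_integral k has_real_derivative hderiv f (k * y)) (at y within {0..})"
proof (cases "k = 0")
  case True
  then show ?thesis by (simp add: price_integral_def[abs_def] hderiv_zero)
next
  case False
  have "(f \<circ> (\<lambda>y. k * y) has_real_derivative hderiv f (k * y) * k) (at y within {0..})"
    by (rule DERIV_image_chain[OF DERIV_subset[OF has_hderiv]])
      (use assms in \<open>auto intro!: derivative_eq_intros\<close>)
  from DERIV_cdivide[OF this, of k] False show ?thesis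
    by (simp add: price_integral_def[abs_def] o_def)
qed

lemma integral_price:
  assumes "0 \<le> k" "0 \<le> a" "a \<le> b"
  shows "integral {a..b} (\<lambda>\<eta>. hderiv f (k * \<eta>)) = price_integral k b - price_integral k a"
proof (rule integral_unique, rule fundamental_theorem_of_calculus)
  fix x assume "x \<in> {a..b}"
  with assms show "(price_integral k has_vector_derivative hderiv f (k * x)) (at x within {a..b})"
    by (auto simp flip: has_real_derivative_iff_has_vector_derivative
        intro!: DERIV_subset[OF price_integral_has_derivative])
qed fact

text \<open>Strictness is what later forces the algorithm's response to the adversary, whatever the
  tie-breaking.\<close>

lemma price_integral_above_tangent_strict:
  assumes "0 < k" "0 \<le> a" "0 \<le> b" "a \<noteq> b"
  shows "price_integral k a + hderiv f (k * a) * (b - a) < price_integral k b"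
proof -
  have "f (k * a) + hderiv f (k * a) * (k * b - k * a) < f (k * b)"
    using above_tangent_strict[of "k * a" "k * b"] assms by simp
  from divide_strict_right_mono[OF this \<open>0 < k\<close>] show ?thesis
    using \<open>0 < k\<close> by (simp add: price_integral_def add_divide_distrib diff_divide_distrib algebra_simps)
qed

lemma price_integral_above_tangent:
  assumes "0 \<le> k" "0 \<le> a" "0 \<le> b"
  shows "price_integral k a + hderiv f (k * a) * (b - a) \<le> price_integral k b"
proof (cases "k = 0 \<or> a = b")
  case True
  then show ?thesis by (auto simp: price_integral_def hderiv_zero)
next
  case False
  then show ?thesis using price_integral_above_tangent_strict[of k a b] assms by simp
qed

lemma price_integral_mono:
  assumes "0 \<le> k" "0 \<le> a" "a \<le> b"
  shows "price_integral k a \<le> price_integral k b"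
proof -
  have "0 \<le> hderiv f (k * a) * (b - a)" using assms hderiv_nonneg by simp
  then show ?thesis using price_integral_above_tangent[of k a b] assms by simp
qed

text \<open>The function that one step of PUMax maximises at loads \<open>y\<close>, with its
  integrals already evaluated.\<close>

definition surplus :: "nat \<Rightarrow> real \<Rightarrow> vec \<Rightarrow> vec \<Rightarrow> vec \<Rightarrow> vec \<Rightarrow> real" where
  "surplus m k v w y z =
     (\<Sum>j<m. v j * z j) - (\<Sum>j<m. price_integral k (y j + w j * z j) - price_integral k (y j))"

text \<open>The derivative along a segment is one-sided: for \<open>e\<close> in
  \<open>{0..1}\<close> all loads stay non-negative, and only there is \<open>price_integral\<close>
  known to be differentiable.\<close>

lemma surplus_has_derivative:
  assumes "0 \<le> k" and w: "\<And>j. j < m \<Longrightarrow> 0 < w j" and y: "\<And>j. j < m \<Longrightarrow> 0 \<le> y j"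
    and x: "x \<in> allocations m" and z: "z \<in> allocations m"
  shows "((\<lambda>e. surplus m k v w y (\<lambda>j. x j + e * (z j - x j))) has_real_derivative
           (\<Sum>j<m. (v j - w j * hderiv f (k * (y j + w j * x j))) * (z j - x j))) (at 0 within {0..1})"
proof -
  have H: "((\<lambda>e. price_integral k (y j + w j * (x j + e * (z j - x j)))) has_real_derivative
          hderiv f (k * (y j + w j * x j)) * (w j * (z j - x j))) (at 0 within {0..1})"
    if j: "j < m" for j
  proof -
    have nonneg: "0 \<le> y j + w j * (x j + e * (z j - x j))" if "e \<in> {0..1}" for e
    proof -
      have "x j + e * (z j - x j) = (1 - e) * x j + e * z j" by (simp add: algebra_simps)
      also have "\<dots> \<ge> 0" using that x z j by (auto simp: allocations_def)
      finally show ?thesis using w[OF j] y[OF j] by simp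
    qed
    have "((price_integral k) \<circ> (\<lambda>e. y j + w j * (x j + e * (z j - x j))) has_real_derivative
          hderiv f (k * (y j + w j * x j)) * (w j * (z j - x j))) (at 0 within {0..1})"
    proof (rule DERIV_image_chain)
      show "(price_integral k has_real_derivative hderiv f (k * (y j + w j * x j)))
        (at (y j + w j * (x j + 0 * (z j - x j))) within
           (\<lambda>e. y j + w j * (x j + e * (z j - x j))) ` {0..1})"
        using nonneg[of 0] nonneg \<open>0 \<le> k\<close>
        by (intro DERIV_subset[OF price_integral_has_derivative, THEN DERIV_cong]) auto
    qed (auto intro!: derivative_eq_intros)
    then show ?thesis by (simp add: o_def)
  qed
  have "((\<lambda>e. \<Sum>j<m. v j * (x j + e * (z j - x j))) has_real_derivative
          (\<Sum>j<m. v j * (z j - x j))) (at 0 within {0..1})"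
    by (auto intro!: derivative_eq_intros simp: mult.commute)
  moreover have "((\<lambda>e. \<Sum>j<m. price_integral k (y j + w j * (x j + e * (z j - x j)))
          - price_integral k (y j)) has_real_derivative
          (\<Sum>j<m. hderiv f (k * (y j + w j * x j)) * (w j * (z j - x j)) - 0)) (at 0 within {0..1})"
    by (intro DERIV_sum DERIV_diff H DERIV_const) auto
  ultimately show ?thesis unfolding surplus_def
    by (rule DERIV_diff[THEN DERIV_cong]) (simp flip: sum_subtractf add: algebra_simps)
qed

text \<open>The variational inequality of a constrained maximiser: a positive derivative towards
  \<open>z\<close> would make a short step in that direction an improvement, and convexity of the
  allocations keeps the step feasible.\<close>

lemma surplus_first_order:
  assumes "0 \<le> k" "\<And>j. j < m \<Longrightarrow> 0 < w j" "\<And>j. j < m \<Longrightarrow> 0 \<le> y j"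
    and max: "is_arg_max (surplus m k v w y) (\<lambda>z. z \<in> allocations m) x"
    and z: "z \<in> allocations m"
  shows "(\<Sum>j<m. (v j - w j * hderiv f (k * (y j + w j * x j))) * z j)
       \<le> (\<Sum>j<m. (v j - w j * hderiv f (k * (y j + w j * x j))) * x j)"
proof (rule ccontr)
  let ?l = "\<Sum>j<m. (v j - w j * hderiv f (k * (y j + w j * x j))) * (z j - x j)"
  let ?s = "\<lambda>e j. x j + e * (z j - x j)"
  have x: "x \<in> allocations m" using max by (simp add: is_arg_max_def)
  assume "\<not> ?thesis"
  then have "0 < ?l" by (simp add: algebra_simps sum_subtractf sum.distrib)
  from has_real_derivative_pos_inc_right[OF surplus_has_derivative[OF assms(1-3) x z] this]
  obtain d where d: "d > 0"
    "\<And>h. h > 0 \<Longrightarrow> h \<in> {0..1} \<Longrightarrow> h < d \<Longrightarrow> surplus m k v w y x < surplus m k v w y (?s h)"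
    by auto
  define h where "h = min 1 (d / 2)"
  have h: "0 < h" "h \<le> 1" "h < d" using d(1) by (auto simp: h_def)
  have s: "?s h = (\<lambda>j. (1 - h) * x j + h * z j)" by (auto simp: algebra_simps)
  have "(\<Sum>j<m. ?s h j) = (1 - h) * sum x {..<m} + h * sum z {..<m}"
    unfolding s by (simp add: sum.distrib sum_distrib_left)
  also have "\<dots> \<le> (1 - h) * 1 + h * 1"
    using x z h by (intro add_mono mult_left_mono) (auto simp: allocations_def)
  finally have "?s h \<in> allocations m"
    using x z h unfolding s by (auto simp: allocations_def)
  moreover have "surplus m k v w y x < surplus m k v w y (?s h)" using d(2)[of h] h by simp
  ultimately show False using max by (auto simp: is_arg_max_def)
qed

text \<open>The set \<open>allocations m\<close> is not compact, because coordinates from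
  \<open>m\<close> on are unconstrained. Setting them to 0 leaves the surplus unchanged and gives a
  closed subset of a product of compact sets.\<close>

lemma surplus_arg_max_exists:
  assumes "0 \<le> k" and w: "\<And>j. j < m \<Longrightarrow> 0 < w j" and y: "\<And>j. j < m \<Longrightarrow> 0 \<le> y j"
  shows "\<exists>x. is_arg_max (surplus m k v w y) (\<lambda>z. z \<in> allocations m) x"
proof -
  let ?B = "\<lambda>j. if j < m then {0..1::real} else {0}"
  define K where "K = PiE UNIV ?B \<inter> {x. (\<Sum>j<m. x j) \<le> 1}"
  have "compact (PiE UNIV ?B)"
    using compactin_PiE[of "\<lambda>_::nat. euclidean :: real topology" UNIV ?B]
    by (auto simp: euclidean_product_topology compactin_euclidean_iff)
  moreover have coord: "continuous_on S (\<lambda>x::vec. x j)" for j S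
    by (intro continuous_on_subset[OF continuous_on_product_coordinates]) auto
  then have "closed {x::vec. (\<Sum>j<m. x j) \<le> 1}"
    by (intro closed_Collect_le continuous_intros) auto
  ultimately have "compact K" unfolding K_def by (rule compact_Int_closed)
  moreover have "(\<lambda>_. 0) \<in> K" by (auto simp: K_def)
  moreover have "continuous_on {0..} (price_integral k)"
    using price_integral_has_derivative[OF \<open>0 \<le> k\<close>] by (intro DERIV_continuous_on) auto
  then have "continuous_on K (\<lambda>z. price_integral k (y j + w j * z j))" if "j < m" for j
    by (rule continuous_on_compose2)
      (use w[OF that] y[OF that] that in
        \<open>auto intro!: continuous_intros coord simp: K_def PiE_def Pi_iff split: if_splits\<close>)
  then have "continuous_on K (surplus m k v w y)" unfolding surplus_def
    by (auto intro!: continuous_intros coord)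
  ultimately obtain x where x: "x \<in> K" "\<And>z. z \<in> K \<Longrightarrow> surplus m k v w y z \<le> surplus m k v w y x"
    using continuous_attains_sup[of K "surplus m k v w y"] by blast
  have "surplus m k v w y z \<le> surplus m k v w y x" if z: "z \<in> allocations m" for z
  proof -
    let ?z = "\<lambda>j. if j < m then z j else 0"
    have "z j \<le> 1" if "j < m" for j
      using z that member_le_sum[of j "{..<m}" z] by (auto simp: allocations_def)
    then have "?z \<in> K" using z by (auto simp: K_def allocations_def)
    then show ?thesis using x(2)[of ?z] by (simp add: surplus_def)
  qed
  moreover have "x \<in> allocations m" using x(1)
    by (auto simp: K_def allocations_def Pi_iff dest!: spec split: if_splits)
  ultimately show ?thesis by (auto simp: is_arg_max_def not_less)
qed

end

section \<open>Competitiveness of linear reserve functions\<close>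

lemma load_0 [simp]: "load I x 0 j = 0"
  by (simp add: load_def)

lemma load_Suc: "load I x (Suc t) j = load I x t j + snd (I ! t) j * x t j"
  by (simp add: load_def)

lemma load_cong: "(\<And>s. s < t \<Longrightarrow> x s = y s) \<Longrightarrow> load I x t = load I y t"
  by (simp add: load_def fun_eq_iff)

lemma is_instance_nth:
  assumes "is_instance m I" "t < length I" "j < m"
  shows "0 \<le> fst (I ! t) j" "0 < snd (I ! t) j"
proof -
  have "case I ! t of (v, w) \<Rightarrow> \<forall>j<m. 0 \<le> v j \<and> 0 < w j"
    using assms(1) nth_mem[OF assms(2)] by (auto simp: is_instance_def)
  with assms(3) show "0 \<le> fst (I ! t) j" "0 < snd (I ! t) j" by (auto split: prod.splits)
qed

lemma load_nonneg:
  assumes "is_instance m I" "t \<le> length I" "\<And>s. s < t \<Longrightarrow> x s \<in> allocations m" "j < m"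
  shows "0 \<le> load I x t j"
  unfolding load_def using assms is_instance_nth(2)[OF assms(1) _ assms(4)]
  by (intro sum_nonneg mult_nonneg_nonneg) (auto simp: allocations_def less_imp_le)

lemma load_mono:
  assumes "is_instance m I" "t \<le> length I" "\<And>s. s < t \<Longrightarrow> x s \<in> allocations m" "j < m" "s \<le> t"
  shows "load I x s j \<le> load I x t j"
  unfolding load_def using assms is_instance_nth(2)[OF assms(1) _ assms(4)]
  by (intro sum_mono2 mult_nonneg_nonneg) (auto simp: allocations_def less_imp_le)

lemma is_arg_max_cong:
  "(\<And>z. P z \<Longrightarrow> f z = g z) \<Longrightarrow> is_arg_max f P x \<longleftrightarrow> is_arg_max g P x"
  by (auto simp: is_arg_max_def)

lemma zero_in_allocations: "(\<lambda>_. 0) \<in> allocations m"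
  by (simp add: allocations_def)

lemma sum_node0: "(\<Sum>j<m. (if j = 0 then c else 0) * x j) = c * x 0" if "1 \<le> m"
  for c :: real and m :: nat
proof -
  have "(\<Sum>j<m. (if j = 0 then c else 0) * x j) = (\<Sum>j<m. if j = 0 then c * x j else 0)"
    by (intro sum.cong) auto
  then show ?thesis using that by simp
qed

lemma node0_in_allocations:
  assumes "1 \<le> m" "0 \<le> s" "s \<le> 1"
  shows "(\<lambda>j. if j = 0 then s else 0) \<in> allocations m"
  using sum_node0[OF assms(1), of s "\<lambda>_. 1"] assms by (auto simp: allocations_def)

section \<open>Existence of runs and sufficiency of the pointwise condition\<close>

context convex_cost
begin

lemma PUMax_iff:
  assumes k: "0 \<le> k" and I: "is_instance m I"
  shows "x \<in> PUMax m f (\<lambda>y. k * y) I \<longleftrightarrow>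
    (\<forall>t<length I. is_arg_max (surplus m k (fst (I ! t)) (snd (I ! t)) (load I x t))
       (\<lambda>z. z \<in> allocations m) (x t))"
proof -
  have *: "is_arg_max
          (\<lambda>z. (\<Sum>j<m. fst (I ! t) j * z j) -
               (\<Sum>j<m. integral {load I x t j .. load I x t j + snd (I ! t) j * z j}
                          (\<lambda>\<eta>. hderiv f (k * \<eta>))))
          (\<lambda>z. z \<in> allocations m) (x t) \<longleftrightarrow>
        is_arg_max (surplus m k (fst (I ! t)) (snd (I ! t)) (load I x t))
          (\<lambda>z. z \<in> allocations m) (x t)"
    if t: "t < length I" and x: "\<forall>t<length I. x t \<in> allocations m" for t
  proof (rule is_arg_max_cong)
    fix z assume z: "z \<in> allocations m"
    have "integral {load I x t j .. load I x t j + snd (I ! t) j * z j} (\<lambda>\<eta>. hderiv f (k * \<eta>))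
        = price_integral k (load I x t j + snd (I ! t) j * z j) - price_integral k (load I x t j)"
      if j: "j < m" for j
    proof (rule integral_price[OF k])
      show "0 \<le> load I x t j" using load_nonneg[OF I _ _ j, of t x] t x by simp
      show "load I x t j \<le> load I x t j + snd (I ! t) j * z j"
        using z j is_instance_nth(2)[OF I t j] by (auto simp: allocations_def)
    qed
    then show "(\<Sum>j<m. fst (I ! t) j * z j) -
               (\<Sum>j<m. integral {load I x t j .. load I x t j + snd (I ! t) j * z j}
                          (\<lambda>\<eta>. hderiv f (k * \<eta>)))
        = surplus m k (fst (I ! t)) (snd (I ! t)) (load I x t) z"
      by (simp add: surplus_def)
  qed
  show ?thesis
  \<comment> \<open>The integrals were evaluated for non-negative loads, hence for feasible
    allocations; otherwise both sides fail, since a maximiser is feasible.\<close>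
  proof (cases "\<forall>t<length I. x t \<in> allocations m")
    case True
    then show ?thesis using * by (simp add: PUMax_def)
  next
    case False
    then show ?thesis by (auto simp: PUMax_def is_arg_max_def)
  qed
qed

lemma PUMax_allocations:
  "x \<in> PUMax m f \<phi> I \<Longrightarrow> t < length I \<Longrightarrow> x t \<in> allocations m"
  by (auto simp: PUMax_def is_arg_max_def)

text \<open>Runs are built demand by demand: the step at \<open>n\<close> depends on earlier
  allocations only, so overwriting \<open>x n\<close> keeps the steps already made optimal.\<close>

lemma PUMax_nonempty:
  assumes k: "0 \<le> k" and I: "is_instance m I"
  shows "PUMax m f (\<lambda>y. k * y) I \<noteq> {}"
proof -
  have "\<exists>x. \<forall>t<n. is_arg_max (surplus m k (fst (I ! t)) (snd (I ! t)) (load I x t))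
          (\<lambda>z. z \<in> allocations m) (x t)" if "n \<le> length I" for n
    using that
  proof (induction n)
    case (Suc n)
    then obtain x where x: "\<And>t. t < n \<Longrightarrow>
        is_arg_max (surplus m k (fst (I ! t)) (snd (I ! t)) (load I x t))
          (\<lambda>z. z \<in> allocations m) (x t)" by auto
    obtain z where z: "is_arg_max (surplus m k (fst (I ! n)) (snd (I ! n)) (load I x n))
          (\<lambda>z. z \<in> allocations m) z"
      using surplus_arg_max_exists[OF k, of m "snd (I ! n)" "load I x n" "fst (I ! n)"]
        is_instance_nth(2)[OF I, of n] load_nonneg[OF I, of n x] Suc.prems x
      by (auto simp: is_arg_max_def)
    have load: "load I (x(n := z)) t = load I x t" if "t \<le> n" for t
      using that by (intro load_cong) auto
    have "is_arg_max (surplus m k (fst (I ! t)) (snd (I ! t)) (load I (x(n := z)) t))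
          (\<lambda>z. z \<in> allocations m) ((x(n := z)) t)" if "t < Suc n" for t
    proof (cases "t = n")
      case True
      then show ?thesis using z by (simp only: load order_refl fun_upd_same)
    next
      case False
      then have "t < n" using that by simp
      then show ?thesis using x[of t] False by (simp only: load[OF less_imp_le] fun_upd_other not_False_eq_True)
    qed
    then show ?case by blast
  qed simp
  then show ?thesis using PUMax_iff[OF k I] by blast
qed

lemma competitive_linear_reserve:
  assumes k: "0 \<le> k" and \<alpha>: "1 \<le> \<alpha>"
    and C: "\<And>y. 0 \<le> y \<Longrightarrow>
      k * y * hderiv f (k * y) - f (k * y) \<le> \<alpha> * (price_integral k y - f y)"
  shows "competitive m f (PUMax m f (\<lambda>y. k * y)) \<alpha>"
  unfolding competitive_def
proof (intro allI impI conjI ballI)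
  fix I assume I: "is_instance m I"
  then show "PUMax m f (\<lambda>y. k * y) I \<noteq> {}" by (rule PUMax_nonempty[OF k])
  fix x assume x: "x \<in> PUMax m f (\<lambda>y. k * y) I"
  note xa = PUMax_allocations[OF x]
  let ?T = "length I"
  let ?v = "\<lambda>t. fst (I ! t)" and ?w = "\<lambda>t. snd (I ! t)"
  let ?y = "load I x ?T"
  define p where "p = (\<lambda>j. hderiv f (k * ?y j))"
  define q where "q = (\<lambda>t j. hderiv f (k * load I x (Suc t) j))"
  \<comment> \<open>The gain when each demand pays the price at the load after its own step. It is
    non-negative because rejecting is feasible, so \<open>1 \<le> \<alpha>\<close> allows it to
    enter the bound on the optimum once and the algorithm's value \<alpha> times.\<close>
  define S where "S = (\<Sum>t<?T. \<Sum>j<m. (?v t j - ?w t j * q t j) * x t j)"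
  have load0: "0 \<le> load I x t j" if "t \<le> ?T" "j < m" for t j
    using load_nonneg[OF I _ _ that(2), of t x] that xa by simp
  have first_order: "(\<Sum>j<m. (?v t j - ?w t j * q t j) * z j)
      \<le> (\<Sum>j<m. (?v t j - ?w t j * q t j) * x t j)"
    if "t < ?T" "z \<in> allocations m" for t z
    unfolding q_def load_Suc
  proof (rule surplus_first_order[OF k])
    show "is_arg_max (surplus m k (?v t) (?w t) (load I x t)) (\<lambda>z. z \<in> allocations m) (x t)"
      using x that(1) unfolding PUMax_iff[OF k I] by blast
  qed (use that is_instance_nth(2)[OF I that(1)] load0[of t] in simp_all)
  have "0 \<le> (\<Sum>j<m. (?v t j - ?w t j * q t j) * x t j)" if "t < ?T" for t
    using first_order[OF that zero_in_allocations] by simp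
  then have S: "0 \<le> S" unfolding S_def by (rule sum_nonneg) simp
  have alg: "S + (\<Sum>j<m. price_integral k (?y j) - f (?y j)) \<le> objective m f I x"
  proof -
    \<comment> \<open>Prices increase with the load, so charging each increment its price after the
      step is an upper sum of the integral.\<close>
    have "price_integral k (?y j) \<le> (\<Sum>t<?T. ?w t j * q t j * x t j)" if j: "j < m" for j
    proof -
      have "price_integral k (load I x (Suc t) j) - price_integral k (load I x t j)
          \<le> ?w t j * q t j * x t j" if "t < ?T" for t
        using price_integral_above_tangent[OF k load0 load0, of "Suc t" j t j] that j
        by (simp add: q_def load_Suc algebra_simps)
      then have "(\<Sum>t<?T. price_integral k (load I x (Suc t) j) - price_integral k (load I x t j))
          \<le> (\<Sum>t<?T. ?w t j * q t j * x t j)" by (intro sum_mono) auto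
      then show ?thesis
        using sum_lessThan_telescope[of "\<lambda>t. price_integral k (load I x t j)" ?T] by simp
    qed
    then have "(\<Sum>j<m. price_integral k (?y j)) \<le> (\<Sum>j<m. \<Sum>t<?T. ?w t j * q t j * x t j)"
      by (intro sum_mono) auto
    also have "\<dots> = (\<Sum>t<?T. \<Sum>j<m. ?w t j * q t j * x t j)" by (rule sum.swap)
    finally show ?thesis
      by (simp add: S_def objective_def sum_subtractf left_diff_distrib)
  qed
  have "objective m f I z \<le> \<alpha> * objective m f I x" if z: "\<forall>t<?T. z t \<in> allocations m" for z
  proof -
    let ?z = "load I z ?T"
    have load_z: "0 \<le> ?z j" if "j < m" for j using load_nonneg[OF I _ _ that, of ?T z] z by simp
    \<comment> \<open>Charging the competitor \<open>z\<close> the final prices, and refunding them,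
      splits its objective into a sum over demands and a sum over nodes.\<close>
    have "(\<Sum>j<m. p j * ?z j) = (\<Sum>j<m. \<Sum>t<?T. ?w t j * p j * z t j)"
      by (simp add: load_def sum_distrib_left mult_ac)
    also have "\<dots> = (\<Sum>t<?T. \<Sum>j<m. ?w t j * p j * z t j)" by (rule sum.swap)
    finally have "objective m f I z =
        (\<Sum>t<?T. \<Sum>j<m. (?v t j - ?w t j * p j) * z t j) + (\<Sum>j<m. p j * ?z j - f (?z j))"
      by (simp add: objective_def sum_subtractf left_diff_distrib)
    also have "(\<Sum>t<?T. \<Sum>j<m. (?v t j - ?w t j * p j) * z t j) \<le> S"
    proof -
      \<comment> \<open>Loads only grow, so final prices dominate the prices \<open>q\<close> at
        which the first-order conditions hold.\<close>
      have "(?v t j - ?w t j * p j) * z t j \<le> (?v t j - ?w t j * q t j) * z t j"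
        if "t < ?T" "j < m" for t j
      proof (intro mult_right_mono diff_left_mono mult_left_mono)
        have "load I x (Suc t) j \<le> ?y j" using load_mono[OF I _ _ that(2), of ?T x "Suc t"] xa that by simp
        then show "q t j \<le> p j" unfolding p_def q_def using that
          by (intro hderiv_le mult_left_mono mult_nonneg_nonneg k load0) auto
      qed (use that z is_instance_nth[OF I that] in \<open>auto simp: allocations_def\<close>)
      then show ?thesis unfolding S_def
        using z by (intro sum_mono order.trans[OF sum_mono first_order]) auto
    qed
    also have "(\<Sum>j<m. p j * ?z j - f (?z j)) \<le> (\<Sum>j<m. \<alpha> * (price_integral k (?y j) - f (?y j)))"
    proof (rule sum_mono)
      fix j assume "j \<in> {..<m}"
      then have j: "j < m" by simp
      \<comment> \<open>Young's inequality with the conjugate evaluated: the final price is the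
        slope of \<open>f\<close> at \<open>k * ?y j\<close>, so the tangent there bounds the left
        side.\<close>
      have "p j * ?z j - f (?z j) \<le> k * ?y j * p j - f (k * ?y j)"
        using above_tangent[of "k * ?y j" "?z j"] k load0[of ?T j] load_z[OF j] j
        by (simp add: p_def algebra_simps)
      also have "\<dots> \<le> \<alpha> * (price_integral k (?y j) - f (?y j))"
        unfolding p_def using C load0[of ?T j] j by simp
      finally show "p j * ?z j - f (?z j) \<le> \<alpha> * (price_integral k (?y j) - f (?y j))" .
    qed
    also have "S + (\<Sum>j<m. \<alpha> * (price_integral k (?y j) - f (?y j)))
        \<le> \<alpha> * (S + (\<Sum>j<m. price_integral k (?y j) - f (?y j)))"
      using mult_right_mono[OF \<alpha> S] by (simp add: sum_distrib_left distrib_left)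
    also have "\<dots> \<le> \<alpha> * objective m f I x"
      using \<alpha> alg by (intro mult_left_mono) auto
    finally show ?thesis by simp
  qed
  then show "OPT m f I \<le> \<alpha> * objective m f I x"
    unfolding OPT_def
    by (intro cSUP_least) (auto intro: exI[of _ "\<lambda>_ _. 0"] simp: zero_in_allocations)
qed

section \<open>The adversary: necessity of the pointwise condition\<close>

lemma objective_le_OPT:
  assumes I: "is_instance m I" and x: "\<And>t. t < length I \<Longrightarrow> x t \<in> allocations m"
  shows "objective m f I x \<le> OPT m f I"
  unfolding OPT_def
proof (rule cSUP_upper)
  \<comment> \<open>A real supremum says nothing without a bound; here allocations are at most 1 in
    each coordinate and costs are non-negative.\<close>
  show "bdd_above (objective m f I ` {x. \<forall>t<length I. x t \<in> allocations m})"
  proof (rule bdd_aboveI2)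
    fix x assume "x \<in> {x. \<forall>t<length I. x t \<in> allocations m}"
    then have x: "\<And>t. t < length I \<Longrightarrow> x t \<in> allocations m" by simp
    have "fst (I ! t) j * x t j \<le> fst (I ! t) j * 1" if "t < length I" "j < m" for t j
      using x[OF that(1)] is_instance_nth[OF I that] that(2) member_le_sum[of j "{..<m}" "x t"]
      by (intro mult_left_mono) (auto simp: allocations_def)
    moreover have "0 \<le> f (load I x (length I) j)" if "j < m" for j
      using load_nonneg[OF I _ _ that, of "length I" x] x by (simp add: nonneg)
    ultimately have "(\<Sum>t<length I. \<Sum>j<m. fst (I ! t) j * x t j) \<le> (\<Sum>t<length I. \<Sum>j<m. fst (I ! t) j * 1)"
      and "0 \<le> (\<Sum>j<m. f (load I x (length I) j))"
      by (auto intro!: sum_mono sum_nonneg)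
    then show "objective m f I x \<le> (\<Sum>t<length I. \<Sum>j<m. fst (I ! t) j * 1)"
      by (simp add: objective_def)
  qed
qed (use x in auto)

text \<open>Serving a node of value 0 cannot increase the surplus, so the maximiser can be compared
  with allocations to node 0 alone.\<close>

lemma arg_max_node0:
  assumes k: "0 \<le> k" and m: "1 \<le> m" and w: "0 < w" and y: "\<And>j. j < m \<Longrightarrow> 0 \<le> y j"
    and max: "is_arg_max (surplus m k (\<lambda>j. if j = 0 then c else 0) (\<lambda>_. w) y) (\<lambda>z. z \<in> allocations m) x"
    and s: "0 \<le> s" "s \<le> 1"
  shows "c * s - price_integral k (y 0 + w * s) \<le> c * x 0 - price_integral k (y 0 + w * x 0)"
proof -
  let ?u = "surplus m k (\<lambda>j. if j = 0 then c else 0) (\<lambda>_. w) y"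
  let ?z = "\<lambda>j::nat. if j = 0 then s else 0"
  have x: "x \<in> allocations m" using max by (simp add: is_arg_max_def)
  have split: "?u z = c * z 0 - (price_integral k (y 0 + w * z 0) - price_integral k (y 0))
      - (\<Sum>j\<in>{..<m} - {0}. price_integral k (y j + w * z j) - price_integral k (y j))" for z
    using sum.remove[of "{..<m}" 0 "\<lambda>j. price_integral k (y j + w * z j) - price_integral k (y j)"] m
    by (simp add: surplus_def sum_node0)
  have "?u ?z \<le> ?u x"
    using max node0_in_allocations[OF m s] by (auto simp: is_arg_max_def not_less)
  also have "?u x \<le> c * x 0 - (price_integral k (y 0 + w * x 0) - price_integral k (y 0))"
    unfolding split using x w y k
    by (simp, intro sum_nonneg) (auto simp: allocations_def intro!: price_integral_mono)
  finally show ?thesis unfolding split by simp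
qed

text \<open>The value per unit of weight is the price at the load after full acceptance; below that
  load the price is lower, so stopping early loses strictly.\<close>

lemma arg_max_node0_full:
  assumes k: "0 < k" and m: "1 \<le> m" and w: "0 < w" and y: "\<And>j. j < m \<Longrightarrow> 0 \<le> y j"
    and max: "is_arg_max (surplus m k (\<lambda>j. if j = 0 then w * hderiv f (k * (y 0 + w)) else 0) (\<lambda>_. w) y)
       (\<lambda>z. z \<in> allocations m) x"
  shows "x 0 = 1"
proof (rule ccontr)
  assume "x 0 \<noteq> 1"
  have "0 \<le> x 0" "0 \<le> y 0" using max y m by (auto simp: is_arg_max_def allocations_def)
  then show False
    using price_integral_above_tangent_strict[OF k, of "y 0 + w" "y 0 + w * x 0"] w \<open>x 0 \<noteq> 1\<close>
      arg_max_node0[OF less_imp_le[OF k] m w y max, of 1]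
    by (simp add: algebra_simps)
qed

text \<open>The value per unit of weight is the current price, and any acceptance raises the price
  strictly above it.\<close>

lemma arg_max_node0_empty:
  assumes k: "0 < k" and m: "1 \<le> m" and w: "0 < w" and y: "\<And>j. j < m \<Longrightarrow> 0 \<le> y j"
    and max: "is_arg_max (surplus m k (\<lambda>j. if j = 0 then w * hderiv f (k * y 0) else 0) (\<lambda>_. w) y)
       (\<lambda>z. z \<in> allocations m) x"
  shows "x 0 = 0"
proof (rule ccontr)
  assume "x 0 \<noteq> 0"
  have "0 \<le> x 0" "0 \<le> y 0" using max y m by (auto simp: is_arg_max_def allocations_def)
  then show False
    using price_integral_above_tangent_strict[OF k, of "y 0" "y 0 + w * x 0"] w \<open>x 0 \<noteq> 0\<close>
      arg_max_node0[OF less_imp_le[OF k] m w y max, of 0]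
    by (simp add: algebra_simps)
qed

text \<open>A right-endpoint sum of an increasing function that vanishes at 0 exceeds the integral
  by at most one step at the final height.\<close>

lemma upper_sum_le_price_integral:
  assumes k: "0 < k" and d: "0 < d"
  shows "(\<Sum>t<n. d * hderiv f (k * (real t * d + d)))
    \<le> price_integral k (real n * d) + d * hderiv f (k * (real n * d))"
proof (induction n)
  case (Suc n)
  then show ?case
    using price_integral_above_tangent[of k "real n * d" "real (Suc n) * d"] k d
    by (simp add: algebra_simps)
qed (simp add: hderiv_zero)

text \<open>The adversary raises the value of node 0 in \<open>N\<close> small steps along the price curve up to
  load \<open>Y\<close>, and then offers one large demand at the price just reached, which the algorithm
  rejects.\<close>

lemma competitive_imp_discrete:
  assumes m: "1 \<le> m" and k: "0 < k" and \<alpha>: "0 \<le> \<alpha>" and Y: "0 < Y" and N: "0 < (N::nat)"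
    and comp: "competitive m f (PUMax m f (\<lambda>y. k * y)) \<alpha>"
  shows "k * Y * hderiv f (k * Y) - f (k * Y)
    \<le> \<alpha> * (price_integral k Y + Y / N * hderiv f (k * Y) - f Y)"
proof -
  define d where "d = Y / N"
  \<comment> \<open>At least \<open>k * Y\<close>, so that a fraction of the last demand can bring
    the offline load of node 0 to \<open>k * Y\<close>.\<close>
  define W where "W = k * Y + 1"
  define I where "I = map (\<lambda>t. (\<lambda>j::nat. if j = 0 then d * hderiv f (k * (real t * d + d)) else 0, \<lambda>_::nat. d)) [0..<N]
    @ [(\<lambda>j. if j = 0 then W * hderiv f (k * Y) else 0, \<lambda>_. W)]"
  have d: "0 < d" and Nd: "real N * d = Y" using Y N by (auto simp: d_def)
  have W: "0 < W" "k * Y \<le> W" using k Y by (auto simp: W_def add_pos_pos)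
  have len [simp]: "length I = Suc N" by (simp add: I_def)
  have nth: "I ! t = (\<lambda>j. if j = 0 then d * hderiv f (k * (real t * d + d)) else 0, \<lambda>_. d)" if "t < N" for t
    using that by (simp add: I_def nth_append fun_eq_iff)
  have nthN: "I ! N = (\<lambda>j. if j = 0 then W * hderiv f (k * Y) else 0, \<lambda>_. W)"
    by (simp add: I_def nth_append)
  have I: "is_instance m I" unfolding is_instance_def
    using d W k Y by (auto simp: I_def intro!: mult_nonneg_nonneg hderiv_nonneg)
  obtain x where x: "x \<in> PUMax m f (\<lambda>y. k * y) I"
    using PUMax_nonempty[OF less_imp_le[OF k] I] by blast
  have load0: "0 \<le> load I x t j" if "t \<le> Suc N" "j < m" for t j
    using load_nonneg[OF I _ _ that(2), of t x] that PUMax_allocations[OF x] by simp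
  have max: "is_arg_max (surplus m k (fst (I ! t)) (snd (I ! t)) (load I x t))
       (\<lambda>z. z \<in> allocations m) (x t)" if "t < Suc N" for t
    using x that unfolding PUMax_iff[OF less_imp_le[OF k] I] by simp
  \<comment> \<open>Acceptance is forced only at exactly the planned load, hence the second premise;
    the induction for \<open>load\<close> discharges it.\<close>
  have full: "x t 0 = 1" if "t < N" "load I x t 0 = real t * d" for t
    using arg_max_node0_full[OF k m d, of "load I x t" "x t"] load0[of t] max[of t] that
    by (simp add: nth cong: if_cong)
  have load: "load I x t 0 = real t * d" if "t \<le> N" for t
    using that by (induction t) (auto simp: load_Suc full nth algebra_simps)
  have empty: "x N 0 = 0"
    using arg_max_node0_empty[OF k m W(1), of "load I x N" "x N"] load0[of N] max[of N] load[of N]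
    by (simp add: nthN Nd cong: if_cong)
  have "objective m f I x = (\<Sum>t<N. d * hderiv f (k * (real t * d + d))) - (\<Sum>j<m. f (load I x (Suc N) j))"
    by (simp add: objective_def sum_node0[OF m] nth nthN empty full load)
  \<comment> \<open>The algorithm may serve other nodes as well, but they have value 0, and their
    cost only lowers its objective.\<close>
  also have "f (load I x (Suc N) 0) \<le> (\<Sum>j<m. f (load I x (Suc N) j))"
    using m load0 by (intro member_le_sum) (auto intro!: nonneg)
  then have "(\<Sum>t<N. d * hderiv f (k * (real t * d + d))) - (\<Sum>j<m. f (load I x (Suc N) j))
      \<le> (\<Sum>t<N. d * hderiv f (k * (real t * d + d))) - f Y"
    by (simp add: load_Suc load empty Nd)
  also have "\<dots> \<le> price_integral k Y + d * hderiv f (k * Y) - f Y"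
    using upper_sum_le_price_integral[OF k d, of N] by (simp add: Nd)
  finally have alg: "\<alpha> * objective m f I x \<le> \<alpha> * (price_integral k Y + d * hderiv f (k * Y) - f Y)"
    using \<alpha> by (rule mult_left_mono)
  \<comment> \<open>The offline competitor skips the first \<open>N\<close> demands and stops at
    load \<open>k * Y\<close>, where marginal cost equals the offered value per unit of
    weight.\<close>
  define z where "z = (\<lambda>t j::nat. if t = N \<and> j = 0 then k * Y / W else 0)"
  have z: "z t \<in> allocations m" for t
    using node0_in_allocations[OF m, of "k * Y / W"] zero_in_allocations[of m] k Y W
    by (cases "t = N") (auto simp: z_def)
  have load_z: "load I z (Suc N) j = (if j = 0 then k * Y else 0)" for j
    using W by (simp add: load_Suc nthN z_def load_def[of _ _ N])
  have "(\<Sum>j<m. f (load I z (Suc N) j)) = (\<Sum>j<m. if j = 0 then f (k * Y) else 0)"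
    by (intro sum.cong) (auto simp: load_z zero)
  also have "\<dots> = f (k * Y)" using m by simp
  finally have "objective m f I z = k * Y * hderiv f (k * Y) - f (k * Y)"
    using W by (simp add: objective_def nth nthN sum_node0[OF m]) (simp add: z_def)
  moreover have "objective m f I z \<le> OPT m f I" using objective_le_OPT[OF I z] .
  moreover have "OPT m f I \<le> \<alpha> * objective m f I x"
    using comp I x by (auto simp: competitive_def)
  ultimately show ?thesis using alg by (simp add: d_def)
qed

lemma competitive_imp:
  assumes "1 \<le> m" "0 < k" and \<alpha>: "0 \<le> \<alpha>" and "0 < Y"
    and "competitive m f (PUMax m f (\<lambda>y. k * y)) \<alpha>"
  shows "k * Y * hderiv f (k * Y) - f (k * Y) \<le> \<alpha> * (price_integral k Y - f Y)"
proof (rule tendsto_lowerbound)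
  have "(\<lambda>N. \<alpha> * (price_integral k Y + Y / real N * hderiv f (k * Y) - f Y))
      \<longlonglongrightarrow> \<alpha> * (price_integral k Y + 0 * hderiv f (k * Y) - f Y)"
    by (intro tendsto_intros lim_const_over_n)
  then show "(\<lambda>N. \<alpha> * (price_integral k Y + Y / real N * hderiv f (k * Y) - f Y))
      \<longlonglongrightarrow> \<alpha> * (price_integral k Y - f Y)" by simp
  show "\<forall>\<^sub>F N in sequentially. k * Y * hderiv f (k * Y) - f (k * Y)
      \<le> \<alpha> * (price_integral k Y + Y / real N * hderiv f (k * Y) - f Y)"
    by (rule eventually_mono[OF eventually_gt_at_top[of 0]])
      (rule competitive_imp_discrete[OF assms(1-4) _ assms(5)])
qed simp

text \<open>With slope 0 every price is 0, so the algorithm accepts a demand of weight 1 worth less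
  than \<open>f 1\<close> and ends with a negative value, while rejecting everything yields
  0.\<close>

lemma not_competitive_zero_reserve:
  assumes m: "1 \<le> m" and \<alpha>: "0 < \<alpha>"
  shows "\<not> competitive m f (PUMax m f (\<lambda>y. 0 * y)) \<alpha>"
proof
  assume comp: "competitive m f (PUMax m f (\<lambda>y. 0 * y)) \<alpha>"
  define c where "c = f 1 / 2"
  have c: "0 < c" "c < f 1" using pos[of 1] by (auto simp: c_def)
  define I where "I = [(\<lambda>j::nat. if j = 0 then c else 0, \<lambda>_::nat. 1::real)]"
  have I: "is_instance m I" using c by (auto simp: is_instance_def I_def)
  obtain x where x: "x \<in> PUMax m f (\<lambda>y. 0 * y) I" using PUMax_nonempty[OF order_refl I] by blast
  then have max: "is_arg_max (surplus m 0 (\<lambda>j. if j = 0 then c else 0) (\<lambda>_. 1) (load I x 0))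
       (\<lambda>z. z \<in> allocations m) (x 0)"
    unfolding PUMax_iff[OF order_refl I] by (simp add: I_def)
  have x0: "x 0 \<in> allocations m" using PUMax_allocations[OF x, of 0] by (simp add: I_def)
  have "c \<le> c * x 0 0"
    using arg_max_node0[OF order_refl m zero_less_one _ max, of 1] by (simp add: price_integral_def)
  moreover have "x 0 0 \<le> 1" using x0 m member_le_sum[of 0 "{..<m}" "x 0"]
    by (auto simp: allocations_def)
  ultimately have x00: "x 0 0 = 1" using c by simp
  have "objective m f I x = c - (\<Sum>j<m. f (x 0 j))"
    using sum_node0[OF m, of c "x 0"] by (simp add: objective_def I_def load_def x00)
  also have "f (x 0 0) \<le> (\<Sum>j<m. f (x 0 j))"
    using m x0 by (intro member_le_sum) (auto intro!: nonneg simp: allocations_def)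
  then have "c - (\<Sum>j<m. f (x 0 j)) < 0" using c by (simp add: x00)
  finally have "\<alpha> * objective m f I x < 0" using \<alpha> by (simp add: mult_pos_neg)
  moreover have "objective m f I (\<lambda>_ _. 0) \<le> OPT m f I"
    by (intro objective_le_OPT I zero_in_allocations)
  moreover have "objective m f I (\<lambda>_ _. 0) = 0" by (simp add: objective_def load_def zero)
  moreover have "OPT m f I \<le> \<alpha> * objective m f I x"
    using comp I x by (auto simp: competitive_def)
  ultimately show False by simp
qed

end

section \<open>Elastic cost functions\<close>

lemma strictly_convex_on_imp_convex_on:
  assumes "strictly_convex_on S f" "convex S"
  shows "convex_on S f"
proof (rule convex_onI)
  fix t x y assume *: "0 < t" "t < (1::real)" "x \<in> S" "y \<in> S"
  show "f ((1 - t) *\<^sub>R x + t *\<^sub>R y) \<le> (1 - t) * f x + t * f y"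
  proof (cases "x = y")
    case True
    then show ?thesis by (simp add: algebra_simps)
  next
    case False
    then have "f ((1 - t) * x + t * y) < (1 - t) * f x + t * f y"
      using assms(1) * unfolding strictly_convex_on_def by blast
    then show ?thesis by simp
  qed
qed fact

text \<open>The factored form shows the sign of the derivative as a bound on the elasticity of
  \<open>g\<close>.\<close>

lemma DERIV_times_powr:
  fixes g :: "real \<Rightarrow> real"
  assumes "(g has_real_derivative D) (at u)" "0 < u"
  shows "((\<lambda>u. g u * u powr a) has_real_derivative (u * D + a * g u) * u powr (a - 1)) (at u)"
proof (rule DERIV_cong)
  show "((\<lambda>u. g u * u powr a) has_real_derivative D * u powr a + a * u powr (a - 1) * g u) (at u)"
    by (rule DERIV_mult[OF assms(1) has_real_derivative_powr[OF assms(2)]])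
  have "u powr a = u * u powr (a - 1)" using powr_mult_base[of u "a - 1"] assms(2) by simp
  then show "D * u powr a + a * u powr (a - 1) * g u = (u * D + a * g u) * u powr (a - 1)"
    by (simp add: algebra_simps)
qed

lemma smooth_half_line_has_hderiv:
  assumes "smooth_half_line f" "0 \<le> x"
  shows "((hderiv ^^ n) f has_real_derivative hderiv ((hderiv ^^ n) f) x) (at x within {0..})"
proof -
  have "(hderiv ^^ n) f differentiable (at x within {0..})"
    using assms by (auto simp: smooth_half_line_def differentiable_on_def)
  then show ?thesis
    by (simp add: hderiv_def vector_derivative_works has_real_derivative_iff_has_vector_derivative)
qed

lemma at_within_half_line: "at x within {0..} = at x" if "0 < x" for x :: real
  using that by (intro at_within_interior) auto

lemma nonneg_deriv_imp_le:
  fixes g g' :: "real \<Rightarrow> real"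
  assumes "a \<le> b" "continuous_on {a..b} g"
    and "\<And>x. a < x \<Longrightarrow> x < b \<Longrightarrow> (g has_real_derivative g' x) (at x)"
    and "\<And>x. a < x \<Longrightarrow> x < b \<Longrightarrow> 0 \<le> g' x"
  shows "g a \<le> g b"
  using assms by (intro DERIV_nonneg_imp_increasing_open[of a b g]) auto

locale elastic_cost =
  fixes \<tau> \<sigma> :: real and f :: "real \<Rightarrow> real"
  assumes elastic: "elastic \<tau> \<sigma> f" and \<tau>: "1 \<le> \<tau>"
begin

lemma smooth: "smooth_half_line f"
  using elastic by (simp add: elastic_def)

lemma deriv_f: "0 \<le> x \<Longrightarrow> (f has_real_derivative hderiv f x) (at x within {0..})"
  using smooth_half_line_has_hderiv[OF smooth, of x 0] by simp

lemma deriv_f': "0 \<le> x \<Longrightarrow> (hderiv f has_real_derivative hderiv (hderiv f) x) (at x within {0..})"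
  using smooth_half_line_has_hderiv[OF smooth, of x 1] by simp

lemma deriv_f'': "0 \<le> x \<Longrightarrow>
    (hderiv (hderiv f) has_real_derivative hderiv (hderiv (hderiv f)) x) (at x within {0..})"
  using smooth_half_line_has_hderiv[OF smooth, of x 2] by (simp add: numeral_2_eq_2)

lemma f_0: "f 0 = 0" and f'_0: "hderiv f 0 = 0"
  using elastic by (simp_all add: elastic_def)

lemma deriv_at:
  assumes "0 < x"
  shows "(f has_real_derivative hderiv f x) (at x)"
    and "(hderiv f has_real_derivative hderiv (hderiv f) x) (at x)"
    and "(hderiv (hderiv f) has_real_derivative hderiv (hderiv (hderiv f)) x) (at x)"
  using deriv_f[of x] deriv_f'[of x] deriv_f''[of x] at_within_half_line[OF assms] assms by simp_all

lemma f'_pos: "0 < hderiv f y" if "0 < y"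
proof -
  have "convex_on {0..} f"
    using elastic by (intro strictly_convex_on_imp_convex_on) (auto simp: elastic_def)
  then have "hderiv f y * (0 - y) \<le> f 0 - f y"
    using that deriv_f[of y] by (intro convex_on_imp_above_tangent[where A="{0..}"]) auto
  moreover have "f 0 < f y"
    using elastic that by (intro strict_mono_onD[of "{0..}" f]) (auto simp: elastic_def)
  ultimately have "0 < hderiv f y * y" by simp
  with that show ?thesis by (simp add: zero_less_mult_iff)
qed

lemma continuous_f': "continuous_on {0..} (hderiv f)"
  using deriv_f' by (intro DERIV_continuous_on) auto

lemma elasticity_bounds:
  assumes "0 < y"
  shows "(\<tau> - 1) * hderiv f y \<le> y * hderiv (hderiv f) y"
    and "y * hderiv (hderiv f) y \<le> (\<sigma> - 1) * hderiv f y"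
  using elastic assms f'_pos[OF assms]
  by (auto simp: elastic_def elasticity_def pos_le_divide_eq pos_divide_le_eq)

lemma f''_nonneg: "0 \<le> hderiv (hderiv f) y" if "0 < y"
proof -
  have "0 \<le> (\<tau> - 1) * hderiv f y" using f'_pos[OF that] \<tau> by simp
  also have "\<dots> \<le> y * hderiv (hderiv f) y" using elasticity_bounds[OF that] by simp
  finally show ?thesis using that by (simp add: zero_le_mult_iff)
qed

text \<open>A zero of \<open>f''\<close> would be a zero of the elasticity of \<open>f'\<close>, which is monotone and
  non-negative; so \<open>f'\<close> would be constant up to that point.\<close>

lemma f''_pos: "0 < hderiv (hderiv f) y" if y: "0 < y"
proof (rule ccontr)
  assume "\<not> ?thesis"
  then have 0: "hderiv (hderiv f) y = 0" using f''_nonneg[OF y] by simp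
  have "hderiv (hderiv f) x = 0" if x: "0 < x" "x \<le> y" for x
  proof -
    have "elasticity (hderiv f) x \<le> elasticity (hderiv f) y"
      using elastic x y by (auto simp: elastic_def monotone_on_def)
    then have "x * hderiv (hderiv f) x / hderiv f x \<le> 0" by (simp add: elasticity_def 0)
    then have "hderiv (hderiv f) x \<le> 0" using x f'_pos[of x]
      by (simp add: divide_le_0_iff mult_le_0_iff)
    then show ?thesis using f''_nonneg[of x] x by simp
  qed
  then have "(hderiv f has_real_derivative 0) (at x)" if "0 < x" "x < y" for x
    using deriv_at(2)[of x] that by simp
  then have "hderiv f y = hderiv f 0"
    using y by (intro DERIV_isconst_end[of 0 y]) (auto intro: continuous_on_subset[OF continuous_f'])
  then show False using f'_pos[OF y] by (simp add: f'_0)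
qed

sublocale convex_cost f
proof
  show "strict_mono_on {0..} (hderiv f)"
  proof (rule strict_mono_onI)
    fix a b :: real assume "a \<in> {0..}" "a < b"
    show "hderiv f a < hderiv f b"
    proof (rule DERIV_pos_imp_increasing_open[OF \<open>a < b\<close>])
      fix x assume "a < x"
      then have "0 < x" using \<open>a \<in> {0..}\<close> by simp
      then show "\<exists>y. (hderiv f has_real_derivative y) (at x) \<and> 0 < y"
        using deriv_at(2) f''_pos by blast
    qed (use \<open>a \<in> {0..}\<close> in \<open>auto intro: continuous_on_subset[OF continuous_f']\<close>)
  qed
qed (use deriv_f f_0 f'_0 in auto)

text \<open>The difference \<open>c * f x - x * hderiv f x\<close> vanishes at 0, and the sign of
  its derivative is exactly a bound \<open>c - 1\<close> on the elasticity of
  \<open>f'\<close>.\<close>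

lemma elasticity_f_bounds:
  assumes "0 \<le> y"
  shows "\<tau> * f y \<le> y * hderiv f y" and "y * hderiv f y \<le> \<sigma> * f y"
proof -
  have cont: "continuous_on {0..y} (\<lambda>x. c * f x - x * hderiv f x)" for c
    by (intro continuous_intros continuous_on_subset[OF continuous] continuous_on_subset[OF continuous_f']) auto
  have der: "((\<lambda>x. c * f x - x * hderiv f x) has_real_derivative
      (c - 1) * hderiv f x - x * hderiv (hderiv f) x) (at x)" if "0 < x" for c x
    using deriv_at[OF that] by (auto intro!: derivative_eq_intros simp: algebra_simps)
  have "\<sigma> * f 0 - 0 * hderiv f 0 \<le> \<sigma> * f y - y * hderiv f y"
    by (rule nonneg_deriv_imp_le[OF assms cont der]) (use elasticity_bounds in auto)
  then show "y * hderiv f y \<le> \<sigma> * f y" by (simp add: f_0)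
  have "- (\<tau> * f 0 - 0 * hderiv f 0) \<le> - (\<tau> * f y - y * hderiv f y)"
    by (rule nonneg_deriv_imp_le[OF assms continuous_on_minus[OF cont] DERIV_minus[OF der]])
      (use elasticity_bounds in auto)
  then show "\<tau> * f y \<le> y * hderiv f y" by (simp add: f_0)
qed

text \<open>By the elasticity bounds, \<open>f u * u powr - c\<close> is non-decreasing for
  \<open>c = \<tau>\<close> and non-increasing for \<open>c = \<sigma>\<close>.\<close>

lemma powr_growth:
  assumes "0 < x" "x \<le> y"
  shows "x powr \<tau> * f y \<ge> y powr \<tau> * f x" and "x powr \<sigma> * f y \<le> y powr \<sigma> * f x"
proof -
  have cont: "continuous_on {x..y} (\<lambda>u. f u * u powr - c)" for c
    using assms by (intro continuous_intros continuous_on_subset[OF continuous]) auto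
  have der: "((\<lambda>u. f u * u powr - c) has_real_derivative
      (u * hderiv f u - c * f u) * u powr (- c - 1)) (at u)" if "x < u" for u c
    using DERIV_times_powr[OF deriv_at(1), of u "- c"] that assms by simp
  have "f x * x powr - \<tau> \<le> f y * y powr - \<tau>"
    by (rule nonneg_deriv_imp_le[OF assms(2) cont der]) (use elasticity_f_bounds assms in auto)
  then show "x powr \<tau> * f y \<ge> y powr \<tau> * f x"
    using assms by (simp add: powr_minus field_simps)
  have "- (f x * x powr - \<sigma>) \<le> - (f y * y powr - \<sigma>)"
    by (rule nonneg_deriv_imp_le[OF assms(2) continuous_on_minus[OF cont] DERIV_minus[OF der]])
      (use elasticity_f_bounds assms in \<open>auto intro!: mult_nonpos_nonneg\<close>)
  then show "x powr \<sigma> * f y \<le> y powr \<sigma> * f x"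
    using assms by (simp add: powr_minus field_simps)
qed

text \<open>If the bound \<open>\<sigma> - 1\<close> on the elasticity of \<open>f'\<close> cannot be improved, it is attained in the
  limit at infinity by monotonicity, and integration transfers this to the elasticity of \<open>f\<close>.\<close>

lemma elasticity_f_sharp:
  assumes sharp: "\<forall>\<sigma>'<\<sigma>. \<not> elastic \<tau> \<sigma>' f" and c: "c < \<sigma>"
  shows "\<exists>y>0. c * f y < y * hderiv f y"
proof (rule ccontr)
  assume "\<not> ?thesis"
  then have upper: "y * hderiv f y \<le> c * f y" if "0 < y" for y using that by force
  define c' where "c' = (c + \<sigma>) / 2"
  have c': "c < c'" "c' < \<sigma>" using c by (auto simp: c'_def)
  \<comment> \<open>All other clauses of \<open>elastic\<close> are inherited from \<sigma>, so at
    \<open>c'\<close> only the upper bound can fail.\<close>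
  obtain Y where Y: "0 < Y" "c' - 1 < elasticity (hderiv f) Y"
    using sharp[rule_format, OF c'(2)] elastic by (auto simp: elastic_def not_le)
  have ge: "(c' - 1) * hderiv f x \<le> x * hderiv (hderiv f) x" if "Y \<le> x" for x
  proof -
    have "elasticity (hderiv f) Y \<le> elasticity (hderiv f) x"
      using elastic Y that by (auto simp: elastic_def monotone_on_def)
    then have "c' - 1 \<le> x * hderiv (hderiv f) x / hderiv f x" using Y(2) by (simp add: elasticity_def)
    then show ?thesis using f'_pos[of x] Y that by (simp add: pos_le_divide_eq)
  qed
  let ?d = "Y * hderiv f Y - c' * f Y"
  have lower: "?d \<le> y * hderiv f y - c' * f y" if "Y \<le> y" for y
  proof (rule nonneg_deriv_imp_le[OF that])
    show "continuous_on {Y..y} (\<lambda>x. x * hderiv f x - c' * f x)" using Y(1)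
      by (intro continuous_intros continuous_on_subset[OF continuous] continuous_on_subset[OF continuous_f']) auto
    show "((\<lambda>x. x * hderiv f x - c' * f x) has_real_derivative
        x * hderiv (hderiv f) x - (c' - 1) * hderiv f x) (at x)" if "Y < x" for x
      using deriv_at[of x] that Y by (auto intro!: derivative_eq_intros simp: algebra_simps)
  qed (use ge in auto)
  \<comment> \<open>Chosen so that the tangent at \<open>Y\<close> alone pushes
    \<open>(c' - c) * f y\<close> up to \<open>\<bar>?d\<bar> + 1\<close>.\<close>
  define y where "y = Y + (\<bar>?d\<bar> + 1) / ((c' - c) * hderiv f Y)"
  have p: "0 < (c' - c) * hderiv f Y" using c' f'_pos[OF Y(1)] by simp
  have y: "Y < y" unfolding y_def using p by (simp add: add_pos_pos)
  have "\<bar>?d\<bar> + 1 = (c' - c) * (hderiv f Y * (y - Y))"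
    using c'(1) f'_pos[OF Y(1)] by (simp add: y_def)
  also have "\<dots> \<le> (c' - c) * f y"
    using above_tangent[of Y y] nonneg[of Y] Y y c' by (intro mult_left_mono) auto
  also have "\<dots> \<le> - ?d" using lower[of y] upper[of y] y Y by (simp add: algebra_simps)
  finally show False by linarith
qed

lemma competitive_imp_reserve_bound:
  assumes sharp: "\<forall>\<sigma>'<\<sigma>. \<not> elastic \<tau> \<sigma>' f" and m: "1 \<le> m" and \<alpha>: "0 < \<alpha>" and k: "0 \<le> k"
    and comp: "competitive m f (PUMax m f (\<lambda>y. k * y)) \<alpha>"
  shows "1 < k" and "\<sigma> - 1 \<le> \<alpha> * (1 / k - k powr - \<sigma>)"
proof -
  have k0: "0 < k"
    using not_competitive_zero_reserve[OF m \<alpha>] comp k by (cases "k = 0") auto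
  \<comment> \<open>The adversary's condition at load \<open>z / k\<close>.\<close>
  have C: "z * hderiv f z - f z \<le> \<alpha> * (f z / k - f (z / k))" if "0 < z" for z
    using competitive_imp[OF m k0 less_imp_le[OF \<alpha>] _ comp, of "z / k"] that k0
    by (simp add: price_integral_def)
  show k1: "1 < k"
  proof (rule ccontr)
    assume "\<not> 1 < k"
    \<comment> \<open>This makes the left side of \<open>C\<close> positive at \<open>z = 1\<close>,
      so \<open>f (1 / k) < f 1 / k\<close>. For \<open>k \<le> 1\<close> the tangent at 1 yields
      the opposite inequality.\<close>
    have "hderiv f 1 - f 1 > 0"
      using above_tangent_strict[of 1 0] by (simp add: f_0)
    then have "0 < \<alpha> * (f 1 / k - f (1 / k))" using C[of 1] by simp
    then have "f (1 / k) * k < f 1" using \<alpha> k0 by (simp add: zero_less_mult_iff field_simps)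
    moreover have "f 1 + hderiv f 1 * (1 / k - 1) \<le> f (1 / k)"
      using above_tangent[of 1 "1 / k"] k0 by simp
    moreover have "f 1 * (1 / k - 1) \<le> hderiv f 1 * (1 / k - 1)"
      using \<open>\<not> 1 < k\<close> k0 \<open>hderiv f 1 - f 1 > 0\<close> by (intro mult_right_mono) (auto simp: field_simps)
    ultimately have "f 1 * (1 / k) \<le> f (1 / k)" by (simp add: algebra_simps)
    then show False using \<open>f (1 / k) * k < f 1\<close> k0 by (simp add: field_simps)
  qed
  show "\<sigma> - 1 \<le> \<alpha> * (1 / k - k powr - \<sigma>)"
  proof (rule ccontr)
    let ?b = "\<alpha> * (1 / k - k powr - \<sigma>)"
    assume "\<not> ?thesis"
    \<comment> \<open>If the bound fails, sharpness provides a point where the elasticity of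
      \<open>f\<close> exceeds \<open>?b + 1\<close>; there the growth estimate for
      \<open>f (z / k)\<close>, which needs \<open>1 < k\<close>, contradicts
      \<open>C\<close>.\<close>
    then obtain z where z: "0 < z" "(?b + 1) * f z < z * hderiv f z"
      using elasticity_f_sharp[OF sharp, of "?b + 1"] by auto
    have "k powr - \<sigma> * f z \<le> f (z / k)"
      using powr_growth(2)[of "z / k" z] z k1 by (simp add: powr_divide powr_minus field_simps)
    then have "f z / k - f (z / k) \<le> (1 / k - k powr - \<sigma>) * f z" by (simp add: algebra_simps)
    then have "\<alpha> * (f z / k - f (z / k)) \<le> \<alpha> * ((1 / k - k powr - \<sigma>) * f z)"
      using \<alpha> by (intro mult_left_mono) auto
    also have "\<dots> = ?b * f z" by simp
    also have "\<dots> < z * hderiv f z - f z" using z(2) by (simp add: algebra_simps)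
    finally show False using C[OF z(1)] by simp
  qed
qed

end

section \<open>Sufficiency of the polynomial condition\<close>

lemma strongly_elastic_competitive:
  assumes f: "strongly_elastic \<tau> \<sigma> f" and \<tau>: "1 \<le> \<tau>" and \<sigma>: "1 < \<sigma>" and \<alpha>: "1 \<le> \<alpha>"
    and k: "1 < k" and bound: "\<sigma> - 1 \<le> \<alpha> * (1 / k - k powr - \<sigma>)"
  shows "competitive m f (PUMax m f (\<lambda>y. k * y)) \<alpha>"
proof -
  interpret elastic_cost \<tau> \<sigma> f
    using f \<tau> by unfold_locales (auto simp: strongly_elastic_def)
  let ?f' = "hderiv f" and ?f'' = "hderiv (hderiv f)" and ?f''' = "hderiv (hderiv (hderiv f))"
  have elast'': "u * ?f''' u + (2 - \<sigma>) * ?f'' u \<le> 0" if "0 < u" for u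
  proof -
    have "u * ?f''' u / ?f'' u \<le> \<sigma> - 2"
      using f that by (simp add: strongly_elastic_def elasticity_def)
    then have "u * ?f''' u \<le> (\<sigma> - 2) * ?f'' u"
      using f''_pos[OF that] by (simp only: pos_divide_le_eq)
    then show ?thesis by (simp add: algebra_simps)
  qed
  have cont'': "continuous_on {0..} ?f''"
    using deriv_f'' by (intro DERIV_continuous_on) auto
  \<comment> \<open>The bound on the elasticity of \<open>f''\<close> says that
    \<open>?f'' x * x powr - (\<sigma> - 2)\<close> is non-increasing.\<close>
  have f''_ge: "?f'' z * (u / z) powr (\<sigma> - 2) \<le> ?f'' u" if u: "0 < u" "u \<le> z" for u z
  proof -
    have cont: "continuous_on {u..z} (\<lambda>x. - (?f'' x * x powr - (\<sigma> - 2)))"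
      using u by (intro continuous_intros continuous_on_subset[OF cont'']) auto
    have der: "((\<lambda>x. - (?f'' x * x powr - (\<sigma> - 2))) has_real_derivative
        - ((x * ?f''' x + - (\<sigma> - 2) * ?f'' x) * x powr (- (\<sigma> - 2) - 1))) (at x)" if "u < x" for x
      using that u by (intro DERIV_minus DERIV_times_powr deriv_at) auto
    have "- (?f'' u * u powr - (\<sigma> - 2)) \<le> - (?f'' z * z powr - (\<sigma> - 2))"
      by (rule nonneg_deriv_imp_le[OF u(2) cont der])
        (use elast'' u in \<open>auto intro!: mult_nonpos_nonneg\<close>)
    moreover have "(u / z) powr (\<sigma> - 2) = z powr - (\<sigma> - 2) / u powr - (\<sigma> - 2)"
      unfolding powr_minus using u by (simp add: powr_divide field_simps)
    ultimately show ?thesis using u by (simp add: pos_divide_le_eq)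
  qed
  have f'_diff: "z * ?f'' z * (1 - k powr (1 - \<sigma>)) \<le> (\<sigma> - 1) * (?f' z - ?f' (z / k))"
    if z: "0 < z" for z
  proof -
    \<comment> \<open>An antiderivative of the slack in \<open>f''_ge\<close>, scaled by
      \<open>\<sigma> - 1\<close>; comparing its values at \<open>z / k\<close> and \<open>z\<close>
      integrates that bound, with equality for pure powers.\<close>
    let ?P = "\<lambda>u. (\<sigma> - 1) * ?f' u - z * ?f'' z * (u / z) powr (\<sigma> - 1)"
    have "?P (z / k) \<le> ?P z"
    proof (rule nonneg_deriv_imp_le[where g="?P"])
      show "z / k \<le> z" using k z by (simp add: field_simps)
      show "continuous_on {z / k..z} ?P"
        using k z by (intro continuous_intros continuous_on_subset[OF continuous_f']) (auto simp: field_simps)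
      fix u assume u: "z / k < u" "u < z"
      have "0 < z / k" using k z by simp
      with u have u0: "0 < u" by linarith
      show "(?P has_real_derivative (\<sigma> - 1) * (?f'' u - ?f'' z * (u / z) powr (\<sigma> - 2))) (at u)"
      proof (rule DERIV_cong)
        have "((\<lambda>u. u / z) has_real_derivative 1 / z) (at u)"
          using z by (auto intro!: derivative_eq_intros)
        then have "((\<lambda>u. (u / z) powr (\<sigma> - 1)) has_real_derivative
            (\<sigma> - 1) * (u / z) powr (\<sigma> - 1 - real 1) * (1 / z)) (at u)"
          using u0 z by (intro DERIV_fun_powr) auto
        then show "(?P has_real_derivative (\<sigma> - 1) * ?f'' u -
            z * ?f'' z * ((\<sigma> - 1) * (u / z) powr (\<sigma> - 1 - real 1) * (1 / z))) (at u)"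
          by (intro DERIV_diff DERIV_cmult deriv_at u0)
      qed (use z in \<open>simp add: algebra_simps\<close>)
      show "0 \<le> (\<sigma> - 1) * (?f'' u - ?f'' z * (u / z) powr (\<sigma> - 2))"
        using f''_ge[OF u0] u \<sigma> by simp
    qed
    moreover have "(z / k / z) powr (\<sigma> - 1) = k powr (1 - \<sigma>)"
      using z k powr_minus[of k "\<sigma> - 1"] by (simp add: powr_divide field_simps)
    ultimately show ?thesis using z by (simp add: algebra_simps)
  qed
  \<comment> \<open>The slack of the pointwise condition at load \<open>z / k\<close>. It vanishes
    at 0, and its derivative involves only \<open>u * ?f'' u\<close> and the increment of
    \<open>f'\<close> bounded in \<open>f'_diff\<close>.\<close>
  have D: "0 \<le> \<alpha> * (f z / k - f (z / k)) - z * ?f' z + f z" if z: "0 \<le> z" for z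
  proof -
    let ?D = "\<lambda>z. \<alpha> * (f z / k - f (z / k)) - z * ?f' z + f z"
    have "?D 0 \<le> ?D z"
    proof (rule nonneg_deriv_imp_le[OF z, where g="?D"])
      have "continuous_on {0..z} (\<lambda>z. f (z / k))"
        using k by (intro continuous_on_compose2[OF continuous]) (auto intro!: continuous_intros)
      then show "continuous_on {0..z} ?D"
        using k by (intro continuous_intros continuous_on_subset[OF continuous]
            continuous_on_subset[OF continuous_f']) auto
      fix u :: real assume u: "0 < u"
      have "((\<lambda>z. f (z / k)) has_real_derivative ?f' (u / k) * (1 / k)) (at u)"
        using deriv_at(1)[of "u / k"] u k
        by (intro DERIV_chain2[where f=f]) (auto intro!: derivative_eq_intros)
      then show "(?D has_real_derivative \<alpha> / k * (?f' u - ?f' (u / k)) - u * ?f'' u) (at u)"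
        using deriv_at[OF u] k by (auto intro!: derivative_eq_intros simp: field_simps)
      have "(\<sigma> - 1) * (u * ?f'' u) \<le> \<alpha> * (1 / k - k powr - \<sigma>) * (u * ?f'' u)"
        using bound u f''_pos[OF u] by (intro mult_right_mono) auto
      also have "1 / k - k powr - \<sigma> = (1 - k powr (1 - \<sigma>)) / k"
        using k powr_add[of k 1 "- \<sigma>"] by (simp add: field_simps)
      also have "\<alpha> * ((1 - k powr (1 - \<sigma>)) / k) * (u * ?f'' u) = \<alpha> / k * (u * ?f'' u * (1 - k powr (1 - \<sigma>)))"
        by simp
      also have "\<dots> \<le> \<alpha> / k * ((\<sigma> - 1) * (?f' u - ?f' (u / k)))"
        using f'_diff[OF u] \<alpha> k by (intro mult_left_mono) auto
      finally have "(\<sigma> - 1) * (u * ?f'' u) \<le> (\<sigma> - 1) * (\<alpha> / k * (?f' u - ?f' (u / k)))"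
        by (simp only: mult.left_commute)
      then have "u * ?f'' u \<le> \<alpha> / k * (?f' u - ?f' (u / k))"
        using \<sigma> by (simp only: mult_le_cancel_left_pos diff_gt_0_iff_gt)
      then show "0 \<le> \<alpha> / k * (?f' u - ?f' (u / k)) - u * ?f'' u" by simp
    qed
    then show ?thesis by (simp add: f_0)
  qed
  show ?thesis
  proof (rule competitive_linear_reserve)
    fix y :: real assume "0 \<le> y"
    then show "k * y * hderiv f (k * y) - f (k * y) \<le> \<alpha> * (price_integral k y - f y)"
      using D[of "k * y"] k by (simp add: price_integral_def)
  qed (use k \<alpha> in auto)
qed

section \<open>The polynomial governing the slope\<close>

lemma Delta_star_gt_1: "1 < Delta_star \<sigma>" if "1 < \<sigma>"
  using that by (simp add: Delta_star_def)

lemma Delta_star_powr: "Delta_star \<sigma> powr (\<sigma> - 1) = \<sigma>" if "1 < \<sigma>"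
  using that by (simp add: Delta_star_def powr_powr)

text \<open>This makes \<open>Delta_star \<sigma>\<close> the minimiser
  \<open>\<alpha> / \<sigma>\<close> of the polynomial at the critical \<alpha>.\<close>

lemma alpha_star_eq: "alpha_star \<sigma> = \<sigma> * Delta_star \<sigma>" if "1 < \<sigma>"
proof -
  have "\<sigma> / (\<sigma> - 1) = 1 + 1 / (\<sigma> - 1)" using that by (simp add: field_simps)
  then show ?thesis using that by (simp add: alpha_star_def Delta_star_def powr_add)
qed

definition reserve_poly :: "real \<Rightarrow> real \<Rightarrow> real \<Rightarrow> real" where
  "reserve_poly \<sigma> \<alpha> z = z powr \<sigma> - \<alpha> / (\<sigma> - 1) * (z powr (\<sigma> - 1) - 1)"

lemma reserve_poly_1: "reserve_poly \<sigma> \<alpha> 1 = 1"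
  by (simp add: reserve_poly_def)

text \<open>In this form the only sign change on the positive axis is visibly at
  \<open>\<alpha> / \<sigma>\<close>.\<close>

lemma reserve_poly_has_derivative:
  assumes "1 < \<sigma>" "0 < z"
  shows "(reserve_poly \<sigma> \<alpha> has_real_derivative z powr (\<sigma> - 2) * (\<sigma> * z - \<alpha>)) (at z)"
proof (rule DERIV_cong)
  show "(reserve_poly \<sigma> \<alpha> has_real_derivative
      \<sigma> * z powr (\<sigma> - 1) - \<alpha> / (\<sigma> - 1) * ((\<sigma> - 1) * z powr (\<sigma> - 1 - 1) - 0)) (at z)"
    unfolding reserve_poly_def[abs_def]
    by (intro DERIV_diff DERIV_cmult has_real_derivative_powr DERIV_const assms)
  have "z powr (\<sigma> - 1) = z * z powr (\<sigma> - 2)"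
    using powr_mult_base[of z "\<sigma> - 2"] assms by simp
  moreover have "\<alpha> / (\<sigma> - 1) * ((\<sigma> - 1) * z powr (\<sigma> - 1 - 1) - 0) = \<alpha> * z powr (\<sigma> - 2)"
    using assms by simp
  ultimately show "\<sigma> * z powr (\<sigma> - 1) - \<alpha> / (\<sigma> - 1) * ((\<sigma> - 1) * z powr (\<sigma> - 1 - 1) - 0)
      = z powr (\<sigma> - 2) * (\<sigma> * z - \<alpha>)"
    by (simp only:) (simp add: algebra_simps)
qed

lemma continuous_on_reserve_poly: "continuous_on {a..b} (reserve_poly \<sigma> \<alpha>)" if "1 < \<sigma>" "0 < a"
  using that DERIV_isCont[OF reserve_poly_has_derivative[OF that(1)]]
  by (intro continuous_at_imp_continuous_on) auto

lemma reserve_poly_decreasing: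
  assumes "1 < \<sigma>" "0 < a" "a < b" "b \<le> \<alpha> / \<sigma>"
  shows "reserve_poly \<sigma> \<alpha> b < reserve_poly \<sigma> \<alpha> a"
proof (rule DERIV_neg_imp_decreasing_open[OF assms(3)])
  fix x assume x: "a < x" "x < b"
  then have "x < \<alpha> / \<sigma>" using assms by simp
  then have "\<sigma> * x < \<alpha>" using assms by (simp add: field_simps)
  then have "x powr (\<sigma> - 2) * (\<sigma> * x - \<alpha>) < 0" using x assms by (intro mult_pos_neg) auto
  then show "\<exists>y. (reserve_poly \<sigma> \<alpha> has_real_derivative y) (at x) \<and> y < 0"
    using reserve_poly_has_derivative[OF assms(1), of x \<alpha>] x assms by force
qed (use assms in \<open>intro continuous_on_reserve_poly\<close>)

lemma reserve_poly_increasing: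
  assumes "1 < \<sigma>" "0 < \<alpha>" "\<alpha> / \<sigma> \<le> a" "a < b"
  shows "reserve_poly \<sigma> \<alpha> a < reserve_poly \<sigma> \<alpha> b"
proof (rule DERIV_pos_imp_increasing_open[OF assms(4)])
  have "0 < \<alpha> / \<sigma>" using assms by simp
  then have a: "0 < a" using assms by linarith
  then show "continuous_on {a..b} (reserve_poly \<sigma> \<alpha>)"
    using assms by (intro continuous_on_reserve_poly)
  fix x assume x: "a < x" "x < b"
  then have "\<alpha> / \<sigma> < x" using assms by simp
  then have "\<alpha> < \<sigma> * x" using assms by (simp add: field_simps)
  then have "0 < x powr (\<sigma> - 2) * (\<sigma> * x - \<alpha>)" using x a by (intro mult_pos_pos) auto
  then show "\<exists>y. (reserve_poly \<sigma> \<alpha> has_real_derivative y) (at x) \<and> 0 < y"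
    using reserve_poly_has_derivative[OF assms(1), of x \<alpha>] x a by force
qed

text \<open>The sign depends on whether \<open>(\<alpha> / \<sigma>) powr (\<sigma> - 1)\<close>
  exceeds \<sigma>, that is, on whether \<alpha> exceeds \<open>alpha_star \<sigma>\<close>.\<close>

lemma reserve_poly_at_minimum:
  assumes "1 < \<sigma>" "0 < \<alpha>"
  shows "reserve_poly \<sigma> \<alpha> (\<alpha> / \<sigma>) = \<alpha> / (\<sigma> - 1) * (1 - (\<alpha> / \<sigma>) powr (\<sigma> - 1) / \<sigma>)"
proof -
  have "(\<alpha> / \<sigma>) powr \<sigma> = (\<alpha> / \<sigma>) * (\<alpha> / \<sigma>) powr (\<sigma> - 1)"
    using powr_mult_base[of "\<alpha> / \<sigma>" "\<sigma> - 1"] assms by simp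
  moreover have "c * p - d * (p - 1) = d * (1 - p / \<sigma>)" if "c = d - d / \<sigma>" for c d p
    unfolding that by (simp add: algebra_simps)
  moreover have "d * (\<sigma> - 1) / \<sigma> = d - d / \<sigma>" for d
    using assms by (simp add: field_simps)
  from this[of "\<alpha> / (\<sigma> - 1)"] have "\<alpha> / \<sigma> = \<alpha> / (\<sigma> - 1) - \<alpha> / (\<sigma> - 1) / \<sigma>"
    using assms by simp
  ultimately show ?thesis unfolding reserve_poly_def by metis
qed

lemma reserve_poly_alpha_star:
  assumes "1 < \<sigma>"
  shows "reserve_poly \<sigma> (alpha_star \<sigma>) (Delta_star \<sigma>) = 0"
  using reserve_poly_at_minimum[OF assms, of "alpha_star \<sigma>"] assms
    alpha_star_eq[OF assms] Delta_star_powr[OF assms] Delta_star_gt_1[OF assms]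
  by simp

text \<open>At the critical \<alpha> the minimum is 0, so the interval of admissible slopes shrinks
  to the minimiser; this is the source of uniqueness.\<close>

lemma reserve_poly_alpha_star_nonpos_iff:
  assumes "1 < \<sigma>" "0 < k"
  shows "reserve_poly \<sigma> (alpha_star \<sigma>) k \<le> 0 \<longleftrightarrow> k = Delta_star \<sigma>"
proof -
  have "alpha_star \<sigma> / \<sigma> = Delta_star \<sigma>" "0 < alpha_star \<sigma>"
    using assms alpha_star_eq[OF assms(1)] Delta_star_gt_1[OF assms(1)] by simp_all
  then show ?thesis
    using reserve_poly_decreasing[of \<sigma> k "Delta_star \<sigma>" "alpha_star \<sigma>"]
      reserve_poly_increasing[of \<sigma> "alpha_star \<sigma>" "Delta_star \<sigma>" k]
      reserve_poly_alpha_star[OF assms(1)] assms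
    by (cases k "Delta_star \<sigma>" rule: linorder_cases) auto
qed

text \<open>Multiplication by \<open>k powr \<sigma>\<close> links the polynomial to the form in
  which both directions of the competitive analysis state the condition.\<close>

lemma reserve_poly_nonpos_iff:
  assumes "1 < \<sigma>" "0 < k"
  shows "reserve_poly \<sigma> \<alpha> k \<le> 0 \<longleftrightarrow> \<sigma> - 1 \<le> \<alpha> * (1 / k - k powr - \<sigma>)"
proof -
  have "reserve_poly \<sigma> \<alpha> k \<le> 0 \<longleftrightarrow> k powr \<sigma> \<le> \<alpha> * (k powr (\<sigma> - 1) - 1) / (\<sigma> - 1)"
    by (simp add: reserve_poly_def)
  also have "\<dots> \<longleftrightarrow> k powr \<sigma> * (\<sigma> - 1) \<le> \<alpha> * (k powr (\<sigma> - 1) - 1)"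
    using assms by (simp add: pos_le_divide_eq)
  also have "\<alpha> * (k powr (\<sigma> - 1) - 1) = k powr \<sigma> * (\<alpha> * (1 / k - k powr - \<sigma>))"
    using assms by (simp add: powr_minus powr_diff field_simps)
  also have "k powr \<sigma> * (\<sigma> - 1) \<le> k powr \<sigma> * (\<alpha> * (1 / k - k powr - \<sigma>)) \<longleftrightarrow>
      \<sigma> - 1 \<le> \<alpha> * (1 / k - k powr - \<sigma>)"
    using assms by (intro mult_le_cancel_left_pos) auto
  finally show ?thesis .
qed

lemma reserve_poly_nonpos_gt_1:
  assumes "1 < \<sigma>" "0 < \<alpha>" "0 < k" "reserve_poly \<sigma> \<alpha> k \<le> 0"
  shows "1 < k"
proof -
  have "0 < k powr \<sigma>" using assms by simp
  also have "\<dots> \<le> \<alpha> / (\<sigma> - 1) * (k powr (\<sigma> - 1) - 1)" using assms(4) by (simp add: reserve_poly_def)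
  finally have "1 < k powr (\<sigma> - 1)" using assms by (simp add: zero_less_mult_iff zero_less_divide_iff)
  then show ?thesis using assms powr_le1[of "\<sigma> - 1" k] by force
qed

lemma reserve_poly_roots:
  assumes \<sigma>: "1 < \<sigma>" and \<alpha>: "alpha_star \<sigma> < \<alpha>"
  obtains a b where "0 < a" "a < b" "{z. 0 < z \<and> reserve_poly \<sigma> \<alpha> z = 0} = {a, b}"
    "\<And>z. a \<le> z \<Longrightarrow> z \<le> b \<Longrightarrow> reserve_poly \<sigma> \<alpha> z \<le> 0"
proof -
  let ?h = "reserve_poly \<sigma> \<alpha>" and ?c = "\<alpha> / \<sigma>"
  have \<Delta>: "Delta_star \<sigma> < ?c" using \<sigma> \<alpha> alpha_star_eq[OF \<sigma>] by (simp add: field_simps)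
  then have c: "1 < ?c" using Delta_star_gt_1[OF \<sigma>] by simp
  then have \<alpha>0: "0 < \<alpha>" using \<sigma> by (simp add: field_simps)
  have "\<sigma> < ?c powr (\<sigma> - 1)"
    using powr_less_mono2[of "\<sigma> - 1" "Delta_star \<sigma>" ?c] \<Delta> \<sigma> Delta_star_gt_1[OF \<sigma>]
    by (simp add: Delta_star_powr)
  then have "1 < ?c powr (\<sigma> - 1) / \<sigma>" using \<sigma> by (simp add: pos_less_divide_eq)
  then have hc: "?h ?c < 0"
    unfolding reserve_poly_at_minimum[OF \<sigma> \<alpha>0] using \<sigma> \<alpha>0 by (intro mult_pos_neg) auto
  obtain a where a: "1 \<le> a" "a \<le> ?c" "?h a = 0"
    using IVT2'[of ?h ?c 0 1] c hc continuous_on_reserve_poly[OF \<sigma>, of 1 ?c \<alpha>]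
    by (auto simp: reserve_poly_1)
  \<comment> \<open>Here the two powers cancel and leave \<open>?h d = d\<close>, a positive value
    to the right of the minimum; to its left the value 1 at 1 serves.\<close>
  define d where "d = \<alpha> / (\<sigma> - 1)"
  have d: "?c \<le> d" "0 < d" using \<sigma> \<alpha>0 by (auto simp: d_def frac_le)
  have "d powr \<sigma> = d * d powr (\<sigma> - 1)" using powr_mult_base[of d "\<sigma> - 1"] d by simp
  then have "?h d = d" by (simp add: reserve_poly_def algebra_simps flip: d_def)
  then obtain b where b: "?c \<le> b" "b \<le> d" "?h b = 0"
    using IVT'[of ?h ?c 0 d] c d hc continuous_on_reserve_poly[OF \<sigma>, of ?c d \<alpha>] by auto
  have ab: "a < ?c" "?c < b" using a b hc by (auto simp: less_le)
  have neg: "?h z \<le> 0" if "a \<le> z" "z \<le> b" for z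
  proof (cases "z \<le> ?c")
    case True
    then show ?thesis using reserve_poly_decreasing[OF \<sigma>, of a z \<alpha>] a that by (cases "a = z") auto
  next
    case False
    then show ?thesis using reserve_poly_increasing[OF \<sigma> \<alpha>0, of z b] b that by (cases "z = b") auto
  qed
  have "z = a \<or> z = b" if "0 < z" "?h z = 0" for z
  proof (cases "z \<le> ?c")
    case True
    then show ?thesis
      using reserve_poly_decreasing[OF \<sigma>, of a z \<alpha>] reserve_poly_decreasing[OF \<sigma>, of z a \<alpha>] a that
      by (cases a z rule: linorder_cases) auto
  next
    case False
    then show ?thesis
      using reserve_poly_increasing[OF \<sigma> \<alpha>0, of b z] reserve_poly_increasing[OF \<sigma> \<alpha>0, of z b] b that
      by (cases b z rule: linorder_cases) auto
  qed
  then have "{z. 0 < z \<and> ?h z = 0} = {a, b}" using a b ab c by auto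
  then show ?thesis using that[of a b] a ab neg by auto
qed

section \<open>An extremal cost function\<close>

lemma (in convex_cost) strictly_convex: "strictly_convex_on {0..} f"
  unfolding strictly_convex_on_def
proof (intro ballI allI impI)
  fix x y u :: real assume *: "x \<in> {0..}" "y \<in> {0..}" "x \<noteq> y" "0 < u" "u < 1"
  define z where "z = (1 - u) * x + u * y"
  have "z - x = u * (y - x)" "y - z = (1 - u) * (y - x)" by (auto simp: z_def algebra_simps)
  then have ne: "z \<noteq> x" "z \<noteq> y" using * by auto
  have "0 \<le> z" using * by (simp add: z_def)
  then have "f z + hderiv f z * (x - z) < f x" "f z + hderiv f z * (y - z) < f y"
    using * ne by (auto intro!: above_tangent_strict)
  then have "(1 - u) * (f z + hderiv f z * (x - z)) + u * (f z + hderiv f z * (y - z))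
      < (1 - u) * f x + u * f y"
    using * by (intro add_strict_mono) auto
  also have "(1 - u) * (f z + hderiv f z * (x - z)) + u * (f z + hderiv f z * (y - z)) = f z"
    by (simp add: z_def algebra_simps)
  finally show "f ((1 - u) * x + u * y) < (1 - u) * f x + u * f y" by (simp add: z_def)
qed

lemma (in convex_cost) strict_mono: "strict_mono_on {0..} f"
proof (rule strict_mono_onI)
  fix a b :: real assume ab: "a \<in> {0..}" "b \<in> {0..}" "a < b"
  then have "0 \<le> hderiv f a * (b - a)" using hderiv_nonneg[of a] by simp
  then show "f a < f b" using above_tangent_strict[of a b] ab by auto
qed

section \<open>One-sided derivatives and smoothness on the half-line\<close>

lemma hderiv_eqI:
  assumes "0 \<le> x" "(f has_real_derivative D) (at x within {0..})"
  shows "hderiv f x = D"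
proof -
  have "at x within {x<..} \<le> at x within {0..}" using assms(1) by (intro at_le) auto
  then have "at x within {0..} \<noteq> bot" using trivial_limit_at_right_real[of x] by (auto simp: bot_unique)
  then show ?thesis using assms(2) unfolding hderiv_def
    by (intro vector_derivative_within) (simp_all add: has_real_derivative_iff_has_vector_derivative)
qed

lemma has_hderiv_cong:
  assumes "\<And>x. 0 \<le> x \<Longrightarrow> u x = h x" "0 \<le> x" "(h has_real_derivative D) (at x within {0..})"
  shows "(u has_real_derivative D) (at x within {0..})"
  by (rule has_field_derivative_transform_within[OF assms(3) zero_less_one]) (use assms in auto)

text \<open>Left of the origin \<open>hderiv\<close> is unspecified, so iterated derivatives meet
  the invariant \<open>P\<close> only up to equality on the half-line; \<open>Q\<close> builds this
  in.\<close>

lemma smooth_half_line_coinduct: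
  assumes "P f"
    and step: "\<And>h. P h \<Longrightarrow> \<exists>h'. P h' \<and> (\<forall>x\<ge>0. (h has_real_derivative h' x) (at x within {0..}))"
  shows "smooth_half_line f"
proof -
  define Q where "Q = (\<lambda>u. \<exists>h. P h \<and> (\<forall>x\<ge>0. u x = h x))"
  have deriv: "\<exists>h'. P h' \<and> (\<forall>x\<ge>0. (u has_real_derivative h' x) (at x within {0..}))" if "Q u" for u
    using that step has_hderiv_cong unfolding Q_def by metis
  have "Q ((hderiv ^^ n) f)" for n
  proof (induction n)
    case 0
    then show ?case using \<open>P f\<close> by (auto simp: Q_def)
  next
    case (Suc n)
    then show ?case using deriv[OF Suc] hderiv_eqI unfolding Q_def by simp metis
  qed
  then show ?thesis
    using deriv unfolding smooth_half_line_def differentiable_on_def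
    by (metis atLeast_iff real_differentiable_def)
qed

text \<open>Let \<open>N\<close> be the order of vanishing of \<open>f\<close> at 0, so that
  \<open>f x / x ^ N\<close> has a non-zero limit. Near 0, \<open>powr_growth\<close> squeezes
  \<open>f x\<close> between \<open>x powr \<sigma> * f 1\<close> and
  \<open>x powr \<tau> * f 1\<close>, which gives \<open>\<tau> \<le> N \<le> \<sigma>\<close>. As
  \<open>f' 0 = 0\<close> excludes \<open>N = 1\<close>, the exponent \<open>N - 1\<close> of
  \<open>f'\<close> is as required.\<close>

lemma (in elastic_cost) leading_exponent:
  obtains n :: nat where "1 \<le> n" "\<tau> - 1 \<le> n" "n \<le> \<sigma> - 1"
proof -
  obtain a r where r: "0 < r" and sums: "\<And>x. x \<in> {0..<r} \<Longrightarrow> (\<lambda>n. a n * x ^ n) sums f x"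
    using elastic unfolding elastic_def analytic_at_origin_def by blast
  have "\<exists>k. a k \<noteq> 0"
  proof (rule ccontr)
    assume "\<not> ?thesis"
    then have "f (r / 2) = 0" using sums[of "r / 2"] r by (auto simp: sums_iff)
    then show False using pos[of "r / 2"] r by simp
  qed
  then obtain N where N: "a N \<noteq> 0" "\<And>k. k < N \<Longrightarrow> a k = 0"
    using exists_least_iff[of "\<lambda>k. a k \<noteq> 0"] by blast
  define F where "F = (\<lambda>x. \<Sum>k. a (k + N) * x ^ k)"
  \<comment> \<open>The limit theorem for power series needs a two-sided neighbourhood, whereas the
    expansion of \<open>f\<close> is given for \<open>x \<ge> 0\<close> only; convergence at
    \<open>r / 2\<close> supplies it.\<close>
  have sums_F: "(\<lambda>k. a (k + N) * x ^ k) sums F x" if "norm x < r / 2" for x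
  proof -
    have "summable (\<lambda>k. a k * (r / 2) ^ k)" using sums[of "r / 2"] r by (auto simp: sums_iff)
    then have "summable (\<lambda>k. a (k + N) * (r / 2) ^ (k + N))" by (rule summable_ignore_initial_segment)
    then have "summable (\<lambda>k. a (k + N) * (r / 2) ^ (k + N) / (r / 2) ^ N)" by (rule summable_divide)
    then have "summable (\<lambda>k. a (k + N) * (r / 2) ^ k)" using r by (simp add: power_add)
    then have "summable (\<lambda>k. a (k + N) * x ^ k)" by (rule powser_inside) (use that r in auto)
    then show ?thesis by (simp add: F_def summable_sums)
  qed
  have f_F: "f x = x ^ N * F x" if "0 < x" "x < r / 2" for x
  proof -
    have "(\<lambda>k. a (k + N) * x ^ (k + N)) sums f x"
      using sums[of x] that N(2) by (subst sums_zero_iff_shift) auto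
    moreover have "(\<lambda>k. x ^ N * (a (k + N) * x ^ k)) sums (x ^ N * F x)"
      using that by (intro sums_mult sums_F) auto
    ultimately show ?thesis by (auto simp: power_add mult_ac intro: sums_unique2)
  qed
  have "(F \<longlongrightarrow> a (0 + N)) (at 0)" by (rule powser_limit_0[of "r / 2", OF _ sums_F]) (use r in auto)
  then have F: "(F \<longlongrightarrow> a N) (at_right 0)" by (auto intro: filterlim_mono at_le)
  have small: "\<forall>\<^sub>F x in at_right 0. 0 < x \<and> x < r / 2 \<and> x < 1"
    using r by (auto simp: eventually_at_right_field intro: exI[of _ "min 1 (r / 2)"])
  have vanish: "((\<lambda>x. x powr d) \<longlongrightarrow> (0::real)) (at_right 0)" if "0 < d" for d
    by (rule tendsto_zero_powrI[OF _ tendsto_const _ that])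
      (auto simp: eventually_at_right_field intro: exI[of _ 1])
  have F_powr: "F x = f x * x powr - real N" if "0 < x" "x < r / 2" for x
    using f_F[OF that] that by (simp add: powr_minus powr_realpow)
  have "N \<le> \<sigma>"
  proof (rule ccontr)
    assume "\<not> N \<le> \<sigma>"
    then have "((\<lambda>x. x powr (N - \<sigma>) * F x) \<longlongrightarrow> 0 * a N) (at_right 0)"
      by (intro tendsto_mult F vanish) auto
    moreover have "\<forall>\<^sub>F x in at_right 0. f 1 \<le> x powr (N - \<sigma>) * F x"
      using small
    proof eventually_elim
      case (elim x)
      then have "f 1 \<le> f x / x powr \<sigma>"
        using powr_growth(2)[of x 1] by (simp add: pos_le_divide_eq mult.commute)
      also have "\<dots> = f x * x powr ((N - \<sigma>) + - real N)"
        by (simp add: powr_minus divide_inverse)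
      also have "\<dots> = x powr (N - \<sigma>) * F x"
        unfolding powr_add using F_powr elim by simp
      finally show ?case .
    qed
    ultimately have "f 1 \<le> 0 * a N" by (intro tendsto_lowerbound) auto
    then show False using pos[of 1] by simp
  qed
  moreover have "\<tau> \<le> N"
  proof (rule ccontr)
    assume "\<not> \<tau> \<le> N"
    then have "((\<lambda>x. x powr (\<tau> - N) * f 1) \<longlongrightarrow> 0 * f 1) (at_right 0)"
      by (intro tendsto_mult tendsto_const vanish) auto
    moreover have "\<forall>\<^sub>F x in at_right 0. norm (F x) \<le> x powr (\<tau> - N) * f 1"
      using small
    proof eventually_elim
      case (elim x)
      then have "F x = f x / x powr N" by (simp add: F_powr powr_minus field_simps)
      moreover have "f x \<le> x powr \<tau> * f 1" "0 < f x"
        using powr_growth(1)[of x 1] pos[of x] elim by simp_all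
      ultimately show ?case using elim by (simp add: powr_diff divide_right_mono)
    qed
    ultimately have "(F \<longlongrightarrow> 0) (at_right 0)" by (simp add: Lim_null_comparison)
    then show False using tendsto_unique[OF _ F] N(1) by auto
  qed
  moreover have "N \<noteq> 1"
  proof
    assume "N = 1"
    have "(f has_real_derivative 0) (at 0 within {0..})" using deriv_f[of 0] by (simp add: f'_0)
    then have "((\<lambda>x. f x / x) \<longlongrightarrow> 0) (at 0 within {0..})"
      by (simp add: has_field_derivative_iff f_0)
    then have "((\<lambda>x. f x / x) \<longlongrightarrow> 0) (at_right 0)"
      by (rule tendsto_mono[OF at_le, rotated]) auto
    moreover have "\<forall>\<^sub>F x in at_right 0. f x / x = F x"
      using small by eventually_elim (simp add: f_F \<open>N = 1\<close>)
    ultimately have "(F \<longlongrightarrow> 0) (at_right 0)" by (rule Lim_transform_eventually)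
    then show False using tendsto_unique[OF _ F] N(1) by auto
  qed
  \<comment> \<open>From \<open>1 \<le> \<tau> \<le> N\<close> and \<open>N \<noteq> 1\<close>
    follows \<open>2 \<le> N\<close>, so the natural subtraction does not truncate.\<close>
  ultimately have "1 \<le> N - 1" "\<tau> - 1 \<le> real (N - 1)" "real (N - 1) \<le> \<sigma> - 1" using \<tau> by linarith+
  then show ?thesis by (rule that)
qed

text \<open>The density \<open>y ^ n * (1 + y) powr c\<close> has elasticity \<open>n + c * y / (1 + y)\<close>, which increases
  from \<open>n\<close> at the origin to \<open>n + c\<close> at infinity. The integer exponent \<open>n\<close> is forced by
  analyticity at the origin.\<close>

definition power_density :: "nat \<Rightarrow> real \<Rightarrow> real \<Rightarrow> real" where
  "power_density n c y = y ^ n * (1 + y) powr c"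

definition power_cost :: "nat \<Rightarrow> real \<Rightarrow> real \<Rightarrow> real" where
  "power_cost n c y = integral {0..y} (power_density n c)"

lemma power_cost_has_derivative:
  assumes "0 \<le> x"
  shows "(power_cost n c has_real_derivative power_density n c x) (at x within {0..})"
proof -
  have "continuous_on {0..x + 1} (power_density n c)"
    unfolding power_density_def by (auto intro!: continuous_intros)
  then have "(power_cost n c has_real_derivative power_density n c x) (at x within {0..x + 1})"
    unfolding power_cost_def using assms by (intro integral_has_real_derivative) auto
  also have "at x within {0..x + 1} = at x within {0..}"
    using assms by (intro at_within_nhd[of x "{..<x + 1}"]) auto
  finally show ?thesis .
qed

lemma hderiv_power_cost: "hderiv (power_cost n c) x = power_density n c x" if "0 \<le> x"
  using that by (intro hderiv_eqI power_cost_has_derivative)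

text \<open>Functions of the form \<open>p(y) * (1 + y) powr q\<close> with a polynomial \<open>p\<close> are closed under
  differentiation.\<close>

lemma smooth_power_cost: "smooth_half_line (power_cost n c)"
proof (rule smooth_half_line_coinduct[where P = "\<lambda>h. h = power_cost n c \<or>
    (\<exists>p q. h = (\<lambda>y::real. poly p y * (1 + y) powr q))"])
  fix h :: "real \<Rightarrow> real"
  assume "h = power_cost n c \<or> (\<exists>p q. h = (\<lambda>y::real. poly p y * (1 + y) powr q))"
  then have "\<exists>p q. \<forall>x\<ge>0. (h has_real_derivative poly p x * (1 + x) powr q) (at x within {0..})"
  proof (elim disjE exE)
    assume "h = power_cost n c"
    then show ?thesis using power_cost_has_derivative
      by (intro exI[of _ "monom 1 n"] exI[of _ c]) (auto simp: power_density_def poly_monom)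
  next
    fix p q assume h: "h = (\<lambda>y::real. poly p y * (1 + y) powr q)"
    have "(h has_real_derivative poly (pderiv p * [:1, 1:] + smult q p) x * (1 + x) powr (q - 1))
        (at x within {0..})" if "0 \<le> x" for x
    proof (rule DERIV_subset[OF DERIV_cong])
      have "((\<lambda>y. 1 + y) has_real_derivative 1) (at x)" by (auto intro!: derivative_eq_intros)
      then have "((\<lambda>y. (1 + y) powr q) has_real_derivative q * (1 + x) powr (q - real 1) * 1) (at x)"
        using that by (intro DERIV_fun_powr) auto
      then show "(h has_real_derivative poly (pderiv p) x * (1 + x) powr q +
          q * (1 + x) powr (q - real 1) * 1 * poly p x) (at x)"
        unfolding h by (intro DERIV_mult poly_DERIV)
      have "(1 + x) powr q = (1 + x) * (1 + x) powr (q - 1)"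
        using powr_mult_base[of "1 + x" "q - 1"] that by simp
      then show "poly (pderiv p) x * (1 + x) powr q + q * (1 + x) powr (q - real 1) * 1 * poly p x
          = poly (pderiv p * [:1, 1:] + smult q p) x * (1 + x) powr (q - 1)"
        by (simp add: algebra_simps)
    qed simp
    then show ?thesis by blast
  qed
  then show "\<exists>h'. (h' = power_cost n c \<or> (\<exists>p q. h' = (\<lambda>y. poly p y * (1 + y) powr q))) \<and>
      (\<forall>x\<ge>0. (h has_real_derivative h' x) (at x within {0..}))"
    by blast
qed simp

lemma power_density_strict_mono:
  assumes "1 \<le> n" "0 \<le> c"
  shows "strict_mono_on {0..} (power_density n c)"
proof (rule strict_mono_onI)
  fix a b :: real assume ab: "a \<in> {0..}" "b \<in> {0..}" "a < b"
  have "a ^ n < b ^ n" using ab assms by (intro power_strict_mono) auto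
  moreover have "(1 + a) powr c \<le> (1 + b) powr c" using ab assms by (intro powr_mono2) auto
  ultimately show "power_density n c a < power_density n c b"
    unfolding power_density_def using ab by (intro mult_less_le_imp_less) auto
qed

text \<open>Established before elasticity, since this locale supplies the positivity, monotonicity
  and strict convexity that \<open>elastic\<close> asks for.\<close>

lemma power_cost_convex_cost:
  assumes "1 \<le> n" "0 \<le> c"
  shows "convex_cost (power_cost n c)"
proof
  show "strict_mono_on {0..} (hderiv (power_cost n c))"
    using power_density_strict_mono[OF assms] by (simp add: strict_mono_on_def hderiv_power_cost)
  show "hderiv (power_cost n c) 0 = 0" using assms by (simp add: hderiv_power_cost power_density_def)
qed (use power_cost_has_derivative in \<open>auto simp: hderiv_power_cost power_cost_def\<close>)

text \<open>The series \<open>b\<close> is the binomial series of \<open>(1 + y) powr c\<close>,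
  shifted by \<open>n\<close> and integrated term by term. On \<open>{0..<1}\<close> it has the same
  derivative as the cost and the same value at 0.\<close>

lemma analytic_power_cost: "analytic_at_origin (power_cost n c)"
proof -
  define b where "b = (\<lambda>j. if j \<le> n then 0 else (c gchoose (j - Suc n)) / real j)"
  let ?G = "\<lambda>x. \<Sum>j. b j * x ^ j"
  have summable: "summable (\<lambda>j. b j * x ^ j)" if x: "norm x < 1" for x
  proof -
    obtain x' where x': "norm x < x'" "x' < 1" using dense[OF x] by blast
    have "summable (\<lambda>j. (c gchoose j) * x' ^ j)"
      using gen_binomial_real[of x' c] x' by (auto simp: sums_iff)
    then have "summable (\<lambda>j. norm ((c gchoose j) * x ^ j))" using x' by (intro powser_insidea) auto
    then have "summable (\<lambda>j. b (j + Suc n) * x ^ (j + Suc n))"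
    proof (rule summable_comparison_test[rotated], intro exI[of _ 0] allI impI)
      fix j :: nat
      have "norm (b (j + Suc n) * x ^ (j + Suc n))
          = norm ((c gchoose j) * x ^ j) * (norm x ^ Suc n / real (j + Suc n))"
        by (simp add: b_def power_add abs_mult power_abs mult_ac)
      also have "\<dots> \<le> norm ((c gchoose j) * x ^ j) * 1"
      proof (rule mult_left_mono)
        have "norm x ^ Suc n \<le> 1" using x by (intro power_le_one) auto
        then show "norm x ^ Suc n / real (j + Suc n) \<le> 1" by simp
      qed simp
      finally show "norm (b (j + Suc n) * x ^ (j + Suc n)) \<le> norm ((c gchoose j) * x ^ j)" by simp
    qed
    then show ?thesis using summable_iff_shift[of "\<lambda>j. b j * x ^ j" "Suc n"] by blast
  qed
  have deriv: "(?G has_real_derivative power_density n c x) (at x)" if "norm x < 1" for x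
  proof -
    have "(\<lambda>j. diffs b (j + n) * x ^ (j + n)) = (\<lambda>j. x ^ n * ((c gchoose j) * x ^ j))"
      by (auto simp: diffs_def b_def power_add fun_eq_iff)
    moreover have "(\<lambda>j. x ^ n * ((c gchoose j) * x ^ j)) sums (x ^ n * (1 + x) powr c)"
      using that by (intro sums_mult gen_binomial_real) auto
    ultimately have "(\<lambda>j. diffs b (j + n) * x ^ (j + n)) sums power_density n c x"
      by (simp add: power_density_def)
    then have "(\<lambda>j. diffs b j * x ^ j) sums power_density n c x"
      by (subst (asm) sums_zero_iff_shift) (auto simp: diffs_def b_def)
    then show ?thesis using termdiffs_strong'[OF summable that] by (simp add: sums_iff)
  qed
  have "?G x = power_cost n c x" if "0 \<le> x" "x < 1" for x
  proof (cases "x = 0")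
    case True
    then show ?thesis by (simp add: power_cost_def b_def)
  next
    case False
    then have x: "0 < x" using that by simp
    have "continuous_on {0..x} (\<lambda>x. ?G x - power_cost n c x)"
    proof (intro continuous_on_diff)
      show "continuous_on {0..x} ?G" using that DERIV_isCont[OF deriv]
        by (intro continuous_at_imp_continuous_on) auto
      show "continuous_on {0..x} (power_cost n c)"
        by (rule DERIV_continuous_on, rule DERIV_subset, rule power_cost_has_derivative) auto
    qed
    moreover have "((\<lambda>x. ?G x - power_cost n c x) has_real_derivative 0) (at y)" if "0 < y" "y < x" for y
      using DERIV_diff[OF deriv[of y], of "power_cost n c" "power_density n c y"]
        power_cost_has_derivative[of y n c] at_within_half_line[of y] that \<open>x < 1\<close> by simp
    ultimately have "?G x - power_cost n c x = ?G 0 - power_cost n c 0"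
      by (intro DERIV_isconst_end[OF x]) auto
    then show ?thesis by (simp add: power_cost_def b_def)
  qed
  then have "(\<lambda>j. b j * x ^ j) sums power_cost n c x" if "x \<in> {0..<1}" for x
    using summable[of x] that by (auto simp: sums_iff)
  then show ?thesis unfolding analytic_at_origin_def by (intro exI[of _ b] exI[of _ 1]) auto
qed

text \<open>The second factor is the logarithmic derivative, and \<open>y\<close> times it is the
  elasticity.\<close>

lemma power_density_derivative:
  assumes "1 \<le> n" "0 < y"
  shows "(power_density n c has_real_derivative power_density n c y * (n / y + c / (1 + y))) (at y)"
proof (rule DERIV_cong)
  have "((\<lambda>y. 1 + y) has_real_derivative 1) (at y)" by (auto intro!: derivative_eq_intros)
  then have *: "((\<lambda>y. (1 + y) powr c) has_real_derivative c * (1 + y) powr (c - real 1) * 1) (at y)"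
    using assms by (intro DERIV_fun_powr) auto
  show "(power_density n c has_real_derivative
      n * y ^ (n - Suc 0) * (1 + y) powr c + c * (1 + y) powr (c - real 1) * 1 * y ^ n) (at y)"
    unfolding power_density_def[abs_def] by (rule DERIV_mult[OF DERIV_pow *])
  have "y ^ n = y * y ^ (n - Suc 0)" using assms by (cases n) auto
  moreover have "(1 + y) powr c = (1 + y) * (1 + y) powr (c - 1)"
    using powr_mult_base[of "1 + y" "c - 1"] assms by simp
  moreover have "y * (1 + y) * (n / y + c / (1 + y)) = n * (1 + y) + c * y"
    by (subst distrib_left) (use assms in simp)
  then have scaled: "p * q * (n * (1 + y) + c * y) = p * q * (y * (1 + y) * (n / y + c / (1 + y)))" for p q :: real
    by (simp only:)
  have "n * p * ((1 + y) * q) + c * q * (y * p) = y * p * ((1 + y) * q) * (n / y + c / (1 + y))" for p q :: real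
    using scaled[of p q] by (simp only: distrib_left[of _ "n * (1 + y)"] mult_ac)
  ultimately show "n * y ^ (n - Suc 0) * (1 + y) powr c + c * (1 + y) powr (c - real 1) * 1 * y ^ n
      = power_density n c y * (n / y + c / (1 + y))"
    by (simp add: power_density_def)
qed

lemma hderiv_at_eqI:
  assumes "0 < x" "(f has_real_derivative D) (at x)"
  shows "hderiv f x = D"
  using assms by (intro hderiv_eqI) (auto intro: DERIV_subset)

text \<open>If \<open>p\<close> is the density and \<open>R = A + B\<close> its logarithmic
  derivative, then f'' is \<open>p * R\<close> and f''' is \<open>p * (R * R + R')\<close> with
  \<open>R' = - A / y - B / (1 + y)\<close>; in the elasticities \<open>p\<close> cancels.\<close>

lemma power_cost_elasticities:
  fixes n :: nat and c y :: real
  assumes "1 \<le> n" "0 < y"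
  defines "A \<equiv> n / y" and "B \<equiv> c / (1 + y)"
  shows "elasticity (hderiv (power_cost n c)) y = n + c - c / (1 + y)"
    and "elasticity (hderiv (hderiv (power_cost n c))) y
      = y * ((A + B) * (A + B) - A / y - B / (1 + y)) / (A + B)"
proof -
  have pos: "0 < power_density n c y" using assms by (simp add: power_density_def)
  let ?R = "\<lambda>y. n / y + c / (1 + y)"
  have f'': "hderiv (hderiv (power_cost n c)) u = power_density n c u * ?R u" if "0 < u" for u
  proof (rule hderiv_eqI)
    show "(hderiv (power_cost n c) has_real_derivative power_density n c u * ?R u) (at u within {0..})"
      by (rule has_hderiv_cong[OF hderiv_power_cost])
        (use power_density_derivative[OF assms(1) that] that in \<open>auto intro: DERIV_subset\<close>)
  qed (use that in simp)
  have "elasticity (hderiv (power_cost n c)) y = y * ?R y"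
    unfolding elasticity_def using pos assms by (simp add: f'' hderiv_power_cost)
  also have "y * ?R y = n + c * (y / (1 + y))" by (subst distrib_left) (use assms in simp)
  also have "y / (1 + y) = 1 - 1 / (1 + y)" using assms by (simp add: field_simps)
  also have "n + c * (1 - 1 / (1 + y)) = n + c - c / (1 + y)" by (simp add: right_diff_distrib)
  finally show "elasticity (hderiv (power_cost n c)) y = n + c - c / (1 + y)" .
  have "((\<lambda>u. power_density n c u * ?R u) has_real_derivative
      power_density n c y * ?R y * ?R y + (- A / y - B / (1 + y)) * power_density n c y) (at y)"
  proof (rule DERIV_mult[OF power_density_derivative[OF assms(1,2)]])
    show "(?R has_real_derivative - A / y - B / (1 + y)) (at y)"
      using assms by (auto intro!: derivative_eq_intros simp: A_def B_def power2_eq_square)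
  qed
  moreover have "power_density n c y * ?R y * ?R y + (- A / y - B / (1 + y)) * power_density n c y
      = power_density n c y * ((A + B) * (A + B) - A / y - B / (1 + y))"
    unfolding A_def[symmetric] B_def[symmetric] by (simp add: algebra_simps)
  ultimately have "((\<lambda>u. power_density n c u * ?R u) has_real_derivative
      power_density n c y * ((A + B) * (A + B) - A / y - B / (1 + y))) (at y)" by (simp only:)
  then have "(hderiv (hderiv (power_cost n c)) has_real_derivative
      power_density n c y * ((A + B) * (A + B) - A / y - B / (1 + y))) (at y)"
    \<comment> \<open>The ball of radius \<open>y\<close> around \<open>y\<close> contains only
      positive numbers, where the formula for f'' is valid.\<close>
    by (rule has_field_derivative_transform_within[OF _ assms(2) UNIV_I])
      (simp add: f'' dist_real_def)
  then have "hderiv (hderiv (hderiv (power_cost n c))) y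
      = power_density n c y * ((A + B) * (A + B) - A / y - B / (1 + y))"
    by (rule hderiv_at_eqI[OF assms(2)])
  then show "elasticity (hderiv (hderiv (power_cost n c))) y
      = y * ((A + B) * (A + B) - A / y - B / (1 + y)) / (A + B)"
    unfolding elasticity_def using pos assms by (simp add: f'')
qed

text \<open>With \<open>t = y / (1 + y)\<close> the elasticity is
  \<open>n + c * t - (A + B * t) / (A + B)\<close>, and the quotient is an average of 1 and
  \<open>t\<close>. Hence the lower bound; the upper one reduces to
  \<open>B \<le> c * (A + B)\<close>, which holds because
  \<open>1 / (1 + y) \<le> A\<close>.\<close>

lemma power_cost_second_elasticity_bounds:
  assumes n: "1 \<le> n" and c: "0 \<le> c" and y: "0 < y"
  shows "real n - 1 \<le> elasticity (hderiv (hderiv (power_cost n c))) y"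
    and "elasticity (hderiv (hderiv (power_cost n c))) y \<le> n + c - 1"
proof -
  define A where "A = n / y"
  define B where "B = c / (1 + y)"
  define t where "t = y / (1 + y)"
  have t: "0 < t" "t < 1" "1 - t = 1 / (1 + y)" using y by (auto simp: t_def field_simps)
  have AB: "0 < A" "0 \<le> B" using n c y by (auto simp: A_def B_def)
  have yAB: "y * (A + B) = n + c * t" unfolding A_def B_def t_def
    by (subst distrib_left) (use y in simp)
  have "y * ((A + B) * (A + B) - A / y - B / (1 + y)) = y * (A + B) * (A + B) - A - B * t"
    using y by (simp add: t_def right_diff_distrib mult_ac)
  also have "\<dots> = (n + c * t) * (A + B) - A - B * t" by (simp only: yAB)
  finally have E: "elasticity (hderiv (hderiv (power_cost n c))) y
      = ((n + c * t) * (A + B) - A - B * t) / (A + B)"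
    using power_cost_elasticities(2)[OF n y, of c] by (simp add: A_def B_def)
  have "B * t \<le> B" "0 \<le> c * t * (A + B)" using t AB c by (auto intro: mult_left_le)
  then have "(real n - 1) * (A + B) \<le> (n + c * t) * (A + B) - A - B * t" by (simp add: algebra_simps)
  then show "real n - 1 \<le> elasticity (hderiv (hderiv (power_cost n c))) y"
    unfolding E using AB by (simp add: pos_le_divide_eq)
  have "1 / (1 + y) \<le> A" using n y unfolding A_def by (intro frac_le) auto
  then have "c * (1 / (1 + y)) \<le> c * (A + B)" using c AB by (intro mult_left_mono) auto
  then have "(1 - t) * B \<le> (1 - t) * (c * (A + B))" using t y by (intro mult_left_mono) (auto simp: B_def)
  then have "(n + c * t) * (A + B) - A - B * t \<le> (n + c - 1) * (A + B)" by (simp add: algebra_simps)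
  then show "elasticity (hderiv (hderiv (power_cost n c))) y \<le> n + c - 1"
    unfolding E using AB by (simp add: pos_divide_le_eq)
qed

lemma strongly_elastic_power_cost:
  assumes n: "1 \<le> n" "\<tau> - 1 \<le> n" and c: "0 \<le> c" "n + c = \<sigma> - 1"
  shows "strongly_elastic \<tau> \<sigma> (power_cost n c)"
    and "\<forall>\<sigma>'<\<sigma>. \<not> elastic \<tau> \<sigma>' (power_cost n c)"
proof -
  interpret convex_cost "power_cost n c" by (rule power_cost_convex_cost[OF n(1) c(1)])
  note E = power_cost_elasticities(1)[OF n(1), of _ c]
  have "elasticity (hderiv (power_cost n c)) x \<le> elasticity (hderiv (power_cost n c)) y"
    if "0 < x" "x \<le> y" for x y
    using that c by (simp add: E frac_le)
  moreover have "\<tau> - 1 \<le> elasticity (hderiv (power_cost n c)) y"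
    "elasticity (hderiv (power_cost n c)) y \<le> \<sigma> - 1" if "0 < y" for y
  proof -
    have "c / (1 + y) \<le> c" using c that by (simp add: divide_le_eq mult_le_cancel_left1)
    then show "\<tau> - 1 \<le> elasticity (hderiv (power_cost n c)) y" using that n by (simp add: E)
    show "elasticity (hderiv (power_cost n c)) y \<le> \<sigma> - 1" using that c by (simp add: E)
  qed
  ultimately have "elastic \<tau> \<sigma> (power_cost n c)"
    using nonneg strict_mono strictly_convex zero hderiv_zero smooth_power_cost analytic_power_cost
    by (auto simp: elastic_def monotone_on_def)
  moreover have "\<tau> - 2 \<le> elasticity (hderiv (hderiv (power_cost n c))) y"
    "elasticity (hderiv (hderiv (power_cost n c))) y \<le> \<sigma> - 2" if "0 < y" for y
    using power_cost_second_elasticity_bounds[OF n(1) c(1) that] n c by linarith+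
  ultimately show "strongly_elastic \<tau> \<sigma> (power_cost n c)" by (auto simp: strongly_elastic_def)
  show "\<forall>\<sigma>'<\<sigma>. \<not> elastic \<tau> \<sigma>' (power_cost n c)"
  proof (intro allI impI notI)
    fix \<sigma>' assume "\<sigma>' < \<sigma>" and el: "elastic \<tau> \<sigma>' (power_cost n c)"
    define d where "d = \<sigma> - \<sigma>'"
    \<comment> \<open>Far enough out that the elasticity falls short of \<open>\<sigma> - 1\<close>
      by less than \<open>d\<close>.\<close>
    define y where "y = c / d + 1"
    have d: "0 < d" using \<open>\<sigma>' < \<sigma>\<close> by (simp add: d_def)
    then have y: "0 < y" using c by (simp add: y_def add_nonneg_pos)
    have "n + c - c / (1 + y) \<le> \<sigma>' - 1" using el y by (auto simp: elastic_def E)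
    then have "d \<le> c / (1 + y)" using c(2) by (simp add: d_def)
    then have "d * (1 + y) \<le> c" using y by (simp add: pos_le_divide_eq)
    then show False using mult_pos_pos[OF d d] d by (simp add: y_def field_simps)
  qed
qed

section \<open>Optimal slopes\<close>

theorem corollary1:
  fixes m :: nat and \<tau> \<sigma> \<alpha> :: real and f :: "real \<Rightarrow> real"
  assumes "1 \<le> m" and "1 \<le> \<tau>" and "\<tau> \<le> \<sigma>" and "1 < \<sigma>"
    and "strongly_elastic \<tau> \<sigma> f"
  shows "(\<alpha> = alpha_star \<sigma> \<longrightarrow>
            competitive m f (PUMax m f (\<lambda>y. Delta_star \<sigma> * y)) \<alpha> \<and>
            (\<forall>\<phi>. linear_reserve \<phi> \<and>
                  (\<forall>g. strongly_elastic \<tau> \<sigma> g \<longrightarrow> competitive m g (PUMax m g \<phi>) \<alpha>)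
                  \<longleftrightarrow> \<phi> = (\<lambda>y. Delta_star \<sigma> * y)) \<and>
            ((\<forall>\<sigma>'<\<sigma>. \<not> elastic \<tau> \<sigma>' f) \<longrightarrow>
               (\<forall>\<phi>. linear_reserve \<phi> \<and> competitive m f (PUMax m f \<phi>) \<alpha>
                     \<longleftrightarrow> \<phi> = (\<lambda>y. Delta_star \<sigma> * y)))) \<and>
         (\<alpha> > alpha_star \<sigma> \<longrightarrow>
            (\<exists>\<Delta>m \<Delta>p. \<Delta>m < \<Delta>p \<and>
               {z. 0 < z \<and> z powr \<sigma> - \<alpha> / (\<sigma> - 1) * (z powr (\<sigma> - 1) - 1) = 0} = {\<Delta>m, \<Delta>p} \<and>
               infinite {\<phi>. linear_reserve \<phi> \<and>
                            (\<forall>y\<ge>0. \<Delta>m * y \<le> \<phi> y \<and> \<phi> y \<le> \<Delta>p * y) \<and>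
                            competitive m f (PUMax m f \<phi>) \<alpha>}))"
proof (intro conjI impI)
  have el: "elastic \<tau> \<sigma> f" using assms(5) by (simp add: strongly_elastic_def)
  interpret elastic_cost \<tau> \<sigma> f using el assms(2) by unfold_locales
  note \<sigma> = \<open>1 < \<sigma>\<close>
  let ?\<Delta> = "Delta_star \<sigma>"
  have \<Delta>: "1 < ?\<Delta>" by (rule Delta_star_gt_1[OF \<sigma>])
  have \<alpha>1: "1 \<le> alpha_star \<sigma>"
    using \<sigma> \<Delta> mult_mono[of 1 \<sigma> 1 ?\<Delta>] by (simp add: alpha_star_eq)
  have competitive: "competitive m g (PUMax m g (\<lambda>y. k * y)) \<alpha>"
    if "strongly_elastic \<tau> \<sigma> g" "alpha_star \<sigma> \<le> \<alpha>" "0 < k" "reserve_poly \<sigma> \<alpha> k \<le> 0" for g \<alpha> k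
    using that \<alpha>1 assms(2) \<sigma>
    by (intro strongly_elastic_competitive[of \<tau> \<sigma>])
      (auto simp flip: reserve_poly_nonpos_iff intro: reserve_poly_nonpos_gt_1[of \<sigma> \<alpha>])
  have star: "competitive m g (PUMax m g (\<lambda>y. ?\<Delta> * y)) (alpha_star \<sigma>)"
    if "strongly_elastic \<tau> \<sigma> g" for g
    using that \<Delta> reserve_poly_alpha_star[OF \<sigma>] by (intro competitive) auto
  have unique: "\<phi> = (\<lambda>y. ?\<Delta> * y)"
    if g: "strongly_elastic \<tau> \<sigma> g" "\<forall>\<sigma>'<\<sigma>. \<not> elastic \<tau> \<sigma>' g"
      and \<phi>: "linear_reserve \<phi>" "competitive m g (PUMax m g \<phi>) (alpha_star \<sigma>)" for g \<phi>
  proof -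
    interpret g: elastic_cost \<tau> \<sigma> g
      using g(1) assms(2) by unfold_locales (simp_all add: strongly_elastic_def)
    obtain k where k: "0 \<le> k" "\<phi> = (\<lambda>y. k * y)" using \<phi>(1) by (auto simp: linear_reserve_def)
    have "0 < alpha_star \<sigma>" using \<alpha>1 by simp
    note bound = g.competitive_imp_reserve_bound[OF g(2) assms(1) this k(1) \<phi>(2)[unfolded k(2)]]
    then have "reserve_poly \<sigma> (alpha_star \<sigma>) k \<le> 0" using \<sigma> by (simp add: reserve_poly_nonpos_iff)
    then show ?thesis using reserve_poly_alpha_star_nonpos_iff[OF \<sigma>, of k] bound(1) k(2) by simp
  qed
  have linear: "linear_reserve (\<lambda>y. ?\<Delta> * y)"
    using \<Delta> by (auto simp: linear_reserve_def intro!: exI[of _ ?\<Delta>])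
  {
    assume \<alpha>: "\<alpha> = alpha_star \<sigma>"
    show "competitive m f (PUMax m f (\<lambda>y. ?\<Delta> * y)) \<alpha>"
      unfolding \<alpha> by (rule star) fact
    \<comment> \<open>Since \<sigma> need not be sharp for \<open>f\<close>, uniqueness over the
      class is tested on a sharp member instead; \<open>f\<close> only witnesses that an admissible
      integer exponent exists.\<close>
    obtain n :: nat where n: "1 \<le> n" "\<tau> - 1 \<le> n" "n \<le> \<sigma> - 1" by (rule leading_exponent)
    let ?g = "power_cost n (\<sigma> - 1 - n)"
    have g: "strongly_elastic \<tau> \<sigma> ?g" "\<forall>\<sigma>'<\<sigma>. \<not> elastic \<tau> \<sigma>' ?g"
      using n by (intro strongly_elastic_power_cost; simp)+
    show "\<forall>\<phi>. linear_reserve \<phi> \<and>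
        (\<forall>g. strongly_elastic \<tau> \<sigma> g \<longrightarrow> competitive m g (PUMax m g \<phi>) \<alpha>) \<longleftrightarrow> \<phi> = (\<lambda>y. ?\<Delta> * y)"
      unfolding \<alpha> using unique[OF g] g(1) star linear by blast
    assume "\<forall>\<sigma>'<\<sigma>. \<not> elastic \<tau> \<sigma>' f"
    then show "\<forall>\<phi>. linear_reserve \<phi> \<and> competitive m f (PUMax m f \<phi>) \<alpha> \<longleftrightarrow> \<phi> = (\<lambda>y. ?\<Delta> * y)"
      unfolding \<alpha> using unique[OF assms(5)] star[OF assms(5)] linear by blast
  next
    assume \<alpha>: "\<alpha> > alpha_star \<sigma>"
    obtain a b where ab: "0 < a" "a < b" "{z. 0 < z \<and> reserve_poly \<sigma> \<alpha> z = 0} = {a, b}"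
      "\<And>z. a \<le> z \<Longrightarrow> z \<le> b \<Longrightarrow> reserve_poly \<sigma> \<alpha> z \<le> 0"
      using reserve_poly_roots[OF \<sigma> \<alpha>] by blast
    let ?S = "{\<phi>. linear_reserve \<phi> \<and> (\<forall>y\<ge>0. a * y \<le> \<phi> y \<and> \<phi> y \<le> b * y) \<and>
      competitive m f (PUMax m f \<phi>) \<alpha>}"
    have "(\<lambda>y. k * y) \<in> ?S" if "k \<in> {a..b}" for k
      using that ab(1) \<alpha> competitive[OF assms(5), of \<alpha> k] ab(4)[of k]
      by (auto simp: linear_reserve_def intro!: mult_right_mono exI[of _ k])
    then have "(\<lambda>k y. k * y) ` {a..b} \<subseteq> ?S" by blast
    \<comment> \<open>Evaluation at 1 recovers the slope, so the slopes in \<open>{a..b}\<close>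
      give infinitely many reserve functions.\<close>
    moreover have "inj_on (\<lambda>k y. k * y) {a..b}"
      by (rule inj_onI) (metis mult.right_neutral)
    ultimately have "infinite ?S"
      using ab(2) finite_imageD[of "\<lambda>k y. k * y" "{a..b}"] finite_subset infinite_Icc by blast
    then show "\<exists>\<Delta>m \<Delta>p. \<Delta>m < \<Delta>p \<and>
               {z. 0 < z \<and> z powr \<sigma> - \<alpha> / (\<sigma> - 1) * (z powr (\<sigma> - 1) - 1) = 0} = {\<Delta>m, \<Delta>p} \<and>
               infinite {\<phi>. linear_reserve \<phi> \<and>
                            (\<forall>y\<ge>0. \<Delta>m * y \<le> \<phi> y \<and> \<phi> y \<le> \<Delta>p * y) \<and>
                            competitive m f (PUMax m f \<phi>) \<alpha>}"
      using ab(2) ab(3)[unfolded reserve_poly_def] by blast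
  }
qed

end
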